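(* Let $V$ be a (nonzero) Euclidean Jordan algebra. Then $V$ is essentially simple if and only if every weakly spectral set in $V$ is spectral.
   Context: A Euclidean Jordan algebra is a finite-dimensional real inner product space $(V,\langle\cdot,\cdot\rangle)$ with a bilinear commutative product $\circ$ having a unit element $e$, such that $x\circ(x^2\circ y)=x^2\circ(x\circ y)$ (where $x^2=x\circ x$) and $\langle x\circ y,z\rangle=\langle y,x\circ z\rangle$ for all $x,y,z\in V$. It is simple if it is not a direct sum/product of nonzero Euclidean Jordan algebras (equivalently, it has no non-trivial ideal). $V$ is essentially simple if it is either (isomorphic to) $\mathbb{R}^n$ with the componentwise product, or simple. An idempotent is an element $c$ with $c^2=c$; it is primitive if it is nonzero and is not a sum of two nonzero idempotents. A Jordan frame is a finite set $\{e_1,\dots,e_n\}$ of primitive idempotents with $e_i\circ e_j=0$ for $i\ne j$ and $\sum_i e_i=e$. All Jordan frames have the same number $n$ of elements, called the rank of $V$. Every $x\in V$ can be written $x=\lambda_1(x)e_1+\cdots+\lambda_n(x)e_n$ with $\{e_1,\dots,e_n\}$ a Jordan frame and uniquely determined real numbers (eigenvalues) $\lambda_1(x)\ge\cdots\ge\lambda_n(x)$; the eigenvalue map is $\lambda:V\to\mathbb{R}^n$, $\lambda(x)=(\lambda_1(x),\dots,\lambda_n(x))$. A set $E\subseteq V$ is spectral if $E=\lambda^{-1}(Q)$ for some permutation invariant set $Q\subseteq\mathbb{R}^n$. An automorphism of $V$ is an invertible linear map $A:V\to V$ with $A(x\circ y)=Ax\circ Ay$ for all $x,y$; $\operatorname{Aut}(V)$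 is the set of all automorphisms. A set $E\subseteq V$ is weakly spectral if $A(E)\subseteq E$ for all $A\in\operatorname{Aut}(V)$. *)

theory Defs
  imports "HOL-Analysis.Analysis" "HOL-Combinatorics.Permutations"
begin

text \<open>
  A Euclidean Jordan algebra is carried by a subspace \<open>V\<close> of a Euclidean space, with the inherited
  inner product, so that its direct summands are again instances of the same locale.
  The values of \<open>mul\<close> outside \<open>V\<close> are irrelevant.
\<close>

locale euclidean_jordan_algebra =
  fixes V :: "'a::euclidean_space set"
    and mul :: "'a \<Rightarrow> 'a \<Rightarrow> 'a"
    and e :: 'a
  assumes subspace: "subspace V"
    and mul_closed: "\<lbrakk>x \<in> V; y \<in> V\<rbrakk> \<Longrightarrow> mul x y \<in> V"
    and mul_add_left: "\<lbrakk>x \<in> V; y \<in> V; z \<in> V\<rbrakk> \<Longrightarrow> mul (x + y) z = mul x z + mul y z"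
    and mul_scaleR_left: "\<lbrakk>x \<in> V; y \<in> V\<rbrakk> \<Longrightarrow> mul (a *\<^sub>R x) y = a *\<^sub>R mul x y"
    and mul_commute: "\<lbrakk>x \<in> V; y \<in> V\<rbrakk> \<Longrightarrow> mul x y = mul y x"
    and unit_closed: "e \<in> V"
    and mul_unit: "x \<in> V \<Longrightarrow> mul e x = x"
    and jordan_identity:
      "\<lbrakk>x \<in> V; y \<in> V\<rbrakk> \<Longrightarrow> mul x (mul (mul x x) y) = mul (mul x x) (mul x y)"
    and inner_associative:
      "\<lbrakk>x \<in> V; y \<in> V; z \<in> V\<rbrakk> \<Longrightarrow> mul x y \<bullet> z = y \<bullet> mul x z"

text \<open>
  \<open>\<real>\<^sup>n\<close> for a variable \<open>n\<close>: coordinates are indexed by \<open>{..<n}\<close> and vanish beyond, as in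
  \<^const>\<open>Euclidean_space\<close>. Hence pointwise operations on functions are the operations of \<open>\<real>\<^sup>n\<close>.
\<close>

definition Rn :: "nat \<Rightarrow> (nat \<Rightarrow> real) set" where
  "Rn n = {x. \<forall>i\<ge>n. x i = 0}"

definition permutation_invariant :: "nat \<Rightarrow> (nat \<Rightarrow> real) set \<Rightarrow> bool" where
  "permutation_invariant n Q \<longleftrightarrow> (\<forall>\<sigma>. \<sigma> permutes {..<n} \<longrightarrow> (\<forall>x\<in>Q. x \<circ> \<sigma> \<in> Q))"

text \<open>
  Direct sums are internal. The two summands are automatically orthogonal: for \<open>x\<close> in \<open>V1\<close> and
  \<open>y\<close> in \<open>V2\<close>, \<open>inner_associative\<close> gives \<open>x \<bullet> y = mul x e1 \<bullet> y = e1 \<bullet> mul x y = 0\<close>.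
\<close>

definition jordan_direct_sum ::
  "'a::euclidean_space set \<Rightarrow> ('a \<Rightarrow> 'a \<Rightarrow> 'a) \<Rightarrow> 'a set \<Rightarrow> 'a set \<Rightarrow> bool" where
  "jordan_direct_sum V mul V1 V2 \<longleftrightarrow>
     (\<exists>e1. euclidean_jordan_algebra V1 mul e1) \<and>
     (\<exists>e2. euclidean_jordan_algebra V2 mul e2) \<and>
     V = {x + y | x y. x \<in> V1 \<and> y \<in> V2} \<and> V1 \<inter> V2 = {0} \<and>
     (\<forall>x\<in>V1. \<forall>y\<in>V2. mul x y = 0)"

definition jordan_simple :: "'a::euclidean_space set \<Rightarrow> ('a \<Rightarrow> 'a \<Rightarrow> 'a) \<Rightarrow> bool" where
  "jordan_simple V mul \<longleftrightarrow>
     \<not> (\<exists>V1 V2. V1 \<noteq> {0} \<and> V2 \<noteq> {0} \<and> jordan_direct_sum V mul V1 V2)"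

text \<open>Isomorphism of algebras; it need not preserve the inner product.\<close>

definition isomorphic_Rn :: "'a::euclidean_space set \<Rightarrow> ('a \<Rightarrow> 'a \<Rightarrow> 'a) \<Rightarrow> nat \<Rightarrow> bool" where
  "isomorphic_Rn V mul n \<longleftrightarrow>
     (\<exists>\<phi>. bij_betw \<phi> V (Rn n) \<and>
       (\<forall>x\<in>V. \<forall>y\<in>V. \<phi> (x + y) = (\<lambda>i. \<phi> x i + \<phi> y i)) \<and>
       (\<forall>a. \<forall>x\<in>V. \<phi> (a *\<^sub>R x) = (\<lambda>i. a * \<phi> x i)) \<and>
       (\<forall>x\<in>V. \<forall>y\<in>V. \<phi> (mul x y) = (\<lambda>i. \<phi> x i * \<phi> y i)))"

definition essentially_simple :: "'a::euclidean_space set \<Rightarrow> ('a \<Rightarrow> 'a \<Rightarrow> 'a) \<Rightarrow> bool" where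
  "essentially_simple V mul \<longleftrightarrow> (\<exists>n. isomorphic_Rn V mul n) \<or> jordan_simple V mul"

definition jordan_idempotent :: "'a set \<Rightarrow> ('a \<Rightarrow> 'a \<Rightarrow> 'a) \<Rightarrow> 'a \<Rightarrow> bool" where
  "jordan_idempotent V mul c \<longleftrightarrow> c \<in> V \<and> mul c c = c"

definition primitive_idempotent ::
  "'a::euclidean_space set \<Rightarrow> ('a \<Rightarrow> 'a \<Rightarrow> 'a) \<Rightarrow> 'a \<Rightarrow> bool" where
  "primitive_idempotent V mul c \<longleftrightarrow>
     jordan_idempotent V mul c \<and> c \<noteq> 0 \<and>
     \<not> (\<exists>a b. jordan_idempotent V mul a \<and> a \<noteq> 0 \<and>
              jordan_idempotent V mul b \<and> b \<noteq> 0 \<and> c = a + b)"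

definition jordan_frame ::
  "'a::euclidean_space set \<Rightarrow> ('a \<Rightarrow> 'a \<Rightarrow> 'a) \<Rightarrow> 'a \<Rightarrow> 'a set \<Rightarrow> bool" where
  "jordan_frame V mul e F \<longleftrightarrow>
     finite F \<and> (\<forall>c\<in>F. primitive_idempotent V mul c) \<and>
     (\<forall>c\<in>F. \<forall>d\<in>F. c \<noteq> d \<longrightarrow> mul c d = 0) \<and> \<Sum>F = e"

definition jordan_rank ::
  "'a::euclidean_space set \<Rightarrow> ('a \<Rightarrow> 'a \<Rightarrow> 'a) \<Rightarrow> 'a \<Rightarrow> nat" where
  "jordan_rank V mul e = (THE n. \<exists>F. jordan_frame V mul e F \<and> card F = n)"

text \<open>
  The eigenvalues are listed in decreasing order as \<open>l 0 \<ge> \<dots> \<ge> l (n - 1)\<close>, where \<open>n\<close> is the rank.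
\<close>

definition eigenvalue_map ::
  "'a::euclidean_space set \<Rightarrow> ('a \<Rightarrow> 'a \<Rightarrow> 'a) \<Rightarrow> 'a \<Rightarrow> 'a \<Rightarrow> nat \<Rightarrow> real" where
  "eigenvalue_map V mul e x =
     (let n = jordan_rank V mul e in
      THE l. l \<in> Rn n \<and> (\<forall>i j. i \<le> j \<and> j < n \<longrightarrow> l j \<le> l i) \<and>
        (\<exists>f. inj_on f {..<n} \<and> jordan_frame V mul e (f ` {..<n}) \<and>
             x = (\<Sum>i<n. l i *\<^sub>R f i)))"

definition spectral_set ::
  "'a::euclidean_space set \<Rightarrow> ('a \<Rightarrow> 'a \<Rightarrow> 'a) \<Rightarrow> 'a \<Rightarrow> 'a set \<Rightarrow> bool" where
  "spectral_set V mul e E \<longleftrightarrow>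
     (\<exists>Q. Q \<subseteq> Rn (jordan_rank V mul e) \<and> permutation_invariant (jordan_rank V mul e) Q \<and>
          E = {x \<in> V. eigenvalue_map V mul e x \<in> Q})"

definition jordan_Aut :: "'a::euclidean_space set \<Rightarrow> ('a \<Rightarrow> 'a \<Rightarrow> 'a) \<Rightarrow> ('a \<Rightarrow> 'a) set" where
  "jordan_Aut V mul =
     {A. bij_betw A V V \<and>
         (\<forall>x\<in>V. \<forall>y\<in>V. A (x + y) = A x + A y) \<and>
         (\<forall>a. \<forall>x\<in>V. A (a *\<^sub>R x) = a *\<^sub>R A x) \<and>
         (\<forall>x\<in>V. \<forall>y\<in>V. A (mul x y) = mul (A x) (A y))}"

definition weakly_spectral_set ::
  "'a::euclidean_space set \<Rightarrow> ('a \<Rightarrow> 'a \<Rightarrow> 'a) \<Rightarrow> 'a set \<Rightarrow> bool" where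
  "weakly_spectral_set V mul E \<longleftrightarrow> E \<subseteq> V \<and> (\<forall>A\<in>jordan_Aut V mul. A ` E \<subseteq> E)"

end

theory Submission imports Defs begin

text \<open>
  Both sides are equivalent to: for every Jordan frame, each of its permutations is induced by an
  automorphism. Weakly spectral sets are the unions of \<open>Aut(V)\<close>-orbits, spectral sets those of fibres
  of the eigenvalue map, and all frames are conjugate, which settles one equivalence.

  All automorphisms needed, except in the case of \<open>\<real>\<^sup>n\<close>, are products of Peirce reflections, which are
  \<open>- 1\<close> on the Peirce 1/2-space of an idempotent and \<open>1\<close> on the other two. Two non-orthogonal primitive
  idempotents \<open>c\<close>, \<open>d\<close> are swapped by the reflection at the idempotent "bisecting" them, which lies in the
  span of \<open>c\<close>, \<open>d\<close>, \<open>cd\<close>; hence it fixes every idempotent orthogonal to both, and frames can be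
  conjugated into each other one element at a time. Orthogonal \<open>c\<close>, \<open>d\<close> are swapped similarly if
  their common Peirce 1/2-space is nonzero. If \<open>V\<close> is simple, any two elements of a frame are joined by
  a chain of such pairs. If \<open>V\<close> splits, a frame contains \<open>c\<close>, \<open>d\<close> from different summands, so
  \<open>c(dz) = 0\<close> for all \<open>z\<close>; homogeneity spreads this to all pairs, whence the frame spans \<open>V\<close>.

  The spectral theorem is obtained by maximising \<open>\<langle>x, c\<rangle> / \<langle>c, c\<rangle>\<close> over the idempotents \<open>c\<close>, without
  power associativity.
\<close>

section \<open>Peirce decomposition\<close>

text \<open>Turns a vector identity into real ones: after pairing with an arbitrary test vector,
  linear combinations of known identities can be handled by real arithmetic. Many product
  computations below end this way.\<close>

lemma eq_by_inner: "x = y" if "\<And>z. x \<bullet> z = y \<bullet> z" for x y :: "'a::real_inner"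
  using that by (metis inner_commute vector_eq_rdot)

context euclidean_jordan_algebra
begin

notation mul (infixl \<open>\<odot>\<close> 70)

section \<open>Elementary rules for the product\<close>

lemmas V_closed [simp] = mul_closed unit_closed subspace_add[OF subspace] subspace_diff[OF subspace]
  subspace_scale[OF subspace] subspace_0[OF subspace] subspace_neg[OF subspace] subspace_sum[OF subspace]

lemma mul_add_right: "\<lbrakk>x \<in> V; y \<in> V; z \<in> V\<rbrakk> \<Longrightarrow> x \<odot> (y + z) = x \<odot> y + x \<odot> z"
  by (metis V_closed(3) mul_add_left mul_commute)

lemma mul_scaleR_right: "\<lbrakk>x \<in> V; y \<in> V\<rbrakk> \<Longrightarrow> x \<odot> (a *\<^sub>R y) = a *\<^sub>R (x \<odot> y)"
  by (metis V_closed(5) mul_scaleR_left mul_commute)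

lemma mul_zero_left: "x \<in> V \<Longrightarrow> 0 \<odot> x = 0"
  using mul_scaleR_left[of 0 x 0] by simp

lemma mul_zero_right: "x \<in> V \<Longrightarrow> x \<odot> 0 = 0"
  using mul_scaleR_right[of x 0 0] by simp

lemma mul_minus_left: "\<lbrakk>x \<in> V; y \<in> V\<rbrakk> \<Longrightarrow> (- x) \<odot> y = - (x \<odot> y)"
  using mul_scaleR_left[of x y "-1"] by simp

lemma mul_minus_right: "\<lbrakk>x \<in> V; y \<in> V\<rbrakk> \<Longrightarrow> x \<odot> (- y) = - (x \<odot> y)"
  using mul_scaleR_right[of x y "-1"] by simp

lemma mul_diff_left: "\<lbrakk>x \<in> V; y \<in> V; z \<in> V\<rbrakk> \<Longrightarrow> (x - y) \<odot> z = x \<odot> z - y \<odot> z"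
  using mul_add_left[of x "-y" z] by (simp add: mul_minus_left)

lemma mul_diff_right: "\<lbrakk>x \<in> V; y \<in> V; z \<in> V\<rbrakk> \<Longrightarrow> x \<odot> (y - z) = x \<odot> y - x \<odot> z"
  using mul_add_right[of x y "-z"] by (simp add: mul_minus_right)

lemma mul_unit_right: "x \<in> V \<Longrightarrow> x \<odot> e = x"
  using mul_commute[of x e] mul_unit by simp

lemmas mul_linear = mul_add_left mul_add_right mul_scaleR_left mul_scaleR_right
  mul_zero_left mul_zero_right mul_minus_left mul_minus_right mul_diff_left mul_diff_right
  mul_unit mul_unit_right

lemma mul_sum_left:
  "\<lbrakk>\<And>i. i \<in> I \<Longrightarrow> f i \<in> V; y \<in> V\<rbrakk> \<Longrightarrow> sum f I \<odot> y = (\<Sum>i\<in>I. f i \<odot> y)"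
  by (induction I rule: infinite_finite_induct) (auto simp: mul_linear)

lemma mul_sum_right:
  "\<lbrakk>\<And>i. i \<in> I \<Longrightarrow> f i \<in> V; y \<in> V\<rbrakk> \<Longrightarrow> y \<odot> sum f I = (\<Sum>i\<in>I. y \<odot> f i)"
  by (induction I rule: infinite_finite_induct) (auto simp: mul_linear)

text \<open>The part of the Jordan identity for \<open>x + z\<close> that is linear in \<open>z\<close>.\<close>

lemma jordan_linearized:
  assumes "x \<in> V" "y \<in> V" "z \<in> V"
  shows "z \<odot> ((x \<odot> x) \<odot> y) + 2 *\<^sub>R (x \<odot> ((x \<odot> z) \<odot> y))
       = (x \<odot> x) \<odot> (z \<odot> y) + 2 *\<^sub>R ((x \<odot> z) \<odot> (x \<odot> y))"
proof -
  note [simp] = assms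
  \<comment> \<open>Subtracting the expansions at \<open>x + z\<close> and \<open>x - z\<close>
    leaves the terms of odd degree in \<open>z\<close>; those of degree three cancel by the Jordan
    identity for \<open>z\<close> itself.\<close>
  have plus: "(x + z) \<odot> (((x + z) \<odot> (x + z)) \<odot> y) = ((x + z) \<odot> (x + z)) \<odot> ((x + z) \<odot> y)"
    by (rule jordan_identity) auto
  have minus: "(x - z) \<odot> (((x - z) \<odot> (x - z)) \<odot> y) = ((x - z) \<odot> (x - z)) \<odot> ((x - z) \<odot> y)"
    by (rule jordan_identity) auto
  have zx: "z \<odot> x = x \<odot> z" by (rule mul_commute) auto
  have jx: "x \<odot> ((x \<odot> x) \<odot> y) = (x \<odot> x) \<odot> (x \<odot> y)"
   and jz: "z \<odot> ((z \<odot> z) \<odot> y) = (z \<odot> z) \<odot> (z \<odot> y)" by (rule jordan_identity; simp)+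
  show ?thesis
  proof (rule eq_by_inner)
    fix t
    show "(z \<odot> ((x \<odot> x) \<odot> y) + 2 *\<^sub>R (x \<odot> ((x \<odot> z) \<odot> y))) \<bullet> t
       = ((x \<odot> x) \<odot> (z \<odot> y) + 2 *\<^sub>R ((x \<odot> z) \<odot> (x \<odot> y))) \<bullet> t"
      using arg_cong[OF plus, of "\<lambda>v. v \<bullet> t"] arg_cong[OF minus, of "\<lambda>v. v \<bullet> t"]
        arg_cong[OF jx, of "\<lambda>v. v \<bullet> t"] arg_cong[OF jz, of "\<lambda>v. v \<bullet> t"]
      by (simp add: mul_linear zx inner_simps)
  qed
qed

lemma idempotent_linearized:
  assumes "c \<in> V" "c \<odot> c = c" "y \<in> V" "z \<in> V"
  shows "z \<odot> (c \<odot> y) + 2 *\<^sub>R (c \<odot> ((c \<odot> z) \<odot> y)) = c \<odot> (z \<odot> y) + 2 *\<^sub>R ((c \<odot> z) \<odot> (c \<odot> y))"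
  using jordan_linearized[of c y z] assms by simp

section \<open>Peirce spaces and their multiplication rules\<close>

definition peirce :: "real \<Rightarrow> 'a \<Rightarrow> 'a set" where
  "peirce a c = {z \<in> V. c \<odot> z = a *\<^sub>R z}"

lemma peirceD: "z \<in> peirce a c \<Longrightarrow> z \<in> V" "z \<in> peirce a c \<Longrightarrow> c \<odot> z = a *\<^sub>R z"
  by (auto simp: peirce_def)

lemma subspace_peirce: "c \<in> V \<Longrightarrow> subspace (peirce a c)"
  unfolding subspace_def peirce_def by (auto simp: mul_linear algebra_simps)

text \<open>Multiplication by \<open>c\<close> is annihilated by t (t - 1/2) (t - 1), so 0, 1/2 and
  1 are its only possible eigenvalues. This is the linearised identity with one of its free
  arguments set to \<open>c\<close>.\<close>

lemma idempotent_cubic: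
  assumes "c \<in> V" "c \<odot> c = c" "z \<in> V"
  shows "c \<odot> (c \<odot> (c \<odot> z)) = (3/2) *\<^sub>R (c \<odot> (c \<odot> z)) - (1/2) *\<^sub>R (c \<odot> z)"
proof -
  note [simp] = assms
  have k: "z \<odot> c = c \<odot> z" "(c \<odot> z) \<odot> c = c \<odot> (c \<odot> z)" by (rule mul_commute; simp)+
  show ?thesis
  proof (rule eq_by_inner)
    fix t show "(c \<odot> (c \<odot> (c \<odot> z))) \<bullet> t = ((3/2) *\<^sub>R (c \<odot> (c \<odot> z)) - (1/2) *\<^sub>R (c \<odot> z)) \<bullet> t"
      using arg_cong[OF idempotent_linearized[of c c z], of "\<lambda>v. v \<bullet> t"]
      by (simp add: k inner_simps)
  qed
qed

text \<open>On eigenvectors the linearised identity collapses to (2a - 1) c(zy) = (2a - 1) b zy,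
  which determines c(zy) unless a = 1/2.\<close>

lemma peirce_mult:
  assumes c: "c \<in> V" "c \<odot> c = c" and a: "a = 0 \<or> a = 1"
    and z: "z \<in> peirce a c" and y: "y \<in> peirce b c"
  shows "z \<odot> y \<in> peirce b c"
proof -
  note [simp] = c peirceD[OF z] peirceD[OF y]
  have "(2 * a - 1) *\<^sub>R (c \<odot> (z \<odot> y)) = (2 * a - 1) *\<^sub>R (b *\<^sub>R (z \<odot> y))"
  proof (rule eq_by_inner)
    fix t show "((2 * a - 1) *\<^sub>R (c \<odot> (z \<odot> y))) \<bullet> t = ((2 * a - 1) *\<^sub>R (b *\<^sub>R (z \<odot> y))) \<bullet> t"
      using arg_cong[OF idempotent_linearized[of c y z], of "\<lambda>v. v \<bullet> t"]
      by (simp add: mul_linear inner_simps algebra_simps)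
  qed
  then show ?thesis using a by (auto simp: peirce_def)
qed

lemma peirce_Int: "z \<in> peirce a c \<Longrightarrow> z \<in> peirce b c \<Longrightarrow> a \<noteq> b \<Longrightarrow> z = 0"
  by (auto simp: peirce_def)

text \<open>By \<open>peirce_mult\<close>, applied once with each factor in front, the product lies
  in both the 0-space and the 1-space.\<close>

lemma peirce_10:
  assumes "c \<in> V" "c \<odot> c = c" "z \<in> peirce 1 c" "y \<in> peirce 0 c"
  shows "z \<odot> y = 0"
proof -
  have "z \<odot> y \<in> peirce 0 c" using peirce_mult assms by blast
  moreover have "y \<odot> z \<in> peirce 1 c" using peirce_mult assms by blast
  ultimately show ?thesis using peirce_Int mul_commute assms peirceD by (metis zero_neq_one)
qed

text \<open>Both terms with factor 2 in the linearised identity contain \<open>c \<odot> z\<close>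
  and vanish.\<close>

lemma commute_peirce_0:
  assumes c: "c \<in> V" "c \<odot> c = c" and z: "z \<in> V" "c \<odot> z = 0" and y: "y \<in> V"
  shows "c \<odot> (z \<odot> y) = z \<odot> (c \<odot> y)"
  using idempotent_linearized[OF c y z(1)] z y c by (simp add: mul_linear)

text \<open>Here \<open>u\<close> is the squared variable of the linearised identity and both other
  arguments are \<open>c\<close>. The mixed terms contribute half of \<open>u \<odot> u\<close> on
  each side and cancel.\<close>

lemma peirce_half_square:
  assumes c: "c \<in> V" "c \<odot> c = c" and u: "u \<in> peirce (1/2) c"
  shows "c \<odot> (c \<odot> (u \<odot> u)) = c \<odot> (u \<odot> u)"
proof -
  note [simp] = c peirceD[OF u]
  have k: "u \<odot> c = (1/2) *\<^sub>R u" "(u \<odot> u) \<odot> c = c \<odot> (u \<odot> u)"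
    using mul_commute[of u c] mul_commute[of "u \<odot> u" c] by auto
  have "c \<odot> (c \<odot> (u \<odot> u)) + 2 *\<^sub>R (u \<odot> ((u \<odot> c) \<odot> c)) = (u \<odot> u) \<odot> (c \<odot> c) + 2 *\<^sub>R ((u \<odot> c) \<odot> (u \<odot> c))"
    using jordan_linearized[of u c c] by (simp add: k)
  then show ?thesis by (simp add: k mul_linear)
qed

text \<open>The sum of the Peirce 1-space and 0-space, encoded by the equation t^2 = t for
  multiplication by \<open>c\<close>, so that membership is a single identity.\<close>

definition even_part :: "'a \<Rightarrow> 'a set" where
  "even_part c = {z \<in> V. c \<odot> (c \<odot> z) = c \<odot> z}"

lemma even_part_decomposition:
  assumes "c \<in> V" "c \<odot> c = c" "z \<in> even_part c"
  shows "\<exists>x\<in>peirce 1 c. \<exists>y\<in>peirce 0 c. z = x + y"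
proof (intro bexI)
  have z: "z \<in> V" "c \<odot> (c \<odot> z) = c \<odot> z" using assms by (auto simp: even_part_def)
  show "c \<odot> z \<in> peirce 1 c" "z - c \<odot> z \<in> peirce 0 c"
    using assms z by (auto simp: peirce_def mul_linear)
  show "z = c \<odot> z + (z - c \<odot> z)" by simp
qed

lemma peirce_imp_even_part:
  "c \<in> V \<Longrightarrow> z \<in> peirce 1 c \<or> z \<in> peirce 0 c \<Longrightarrow> z \<in> even_part c"
  by (auto simp: peirce_def even_part_def mul_linear)

lemma subspace_even_part: "c \<in> V \<Longrightarrow> subspace (even_part c)"
  unfolding subspace_def even_part_def by (auto simp: mul_linear algebra_simps)

text \<open>This and the next two lemmas make the splitting into \<open>even_part c\<close> and the
  1/2-space a grading modulo 2; hence changing the sign of the odd part is multiplicative.\<close>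

lemma even_mult_even:
  assumes c: "c \<in> V" "c \<odot> c = c" and "x \<in> even_part c" "y \<in> even_part c"
  shows "x \<odot> y \<in> even_part c"
proof -
  obtain x1 x0 where x: "x1 \<in> peirce 1 c" "x0 \<in> peirce 0 c" "x = x1 + x0"
    using even_part_decomposition[OF c \<open>x \<in> even_part c\<close>] by blast
  obtain y1 y0 where y: "y1 \<in> peirce 1 c" "y0 \<in> peirce 0 c" "y = y1 + y0"
    using even_part_decomposition[OF c \<open>y \<in> even_part c\<close>] by blast
  note [simp] = c peirceD[OF x(1)] peirceD[OF x(2)] peirceD[OF y(1)] peirceD[OF y(2)]
  have "x1 \<odot> y0 = 0" "y1 \<odot> x0 = 0" using peirce_10[OF c] x y by blast+
  moreover have "y1 \<odot> x0 = x0 \<odot> y1" by (rule mul_commute) auto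
  ultimately have "x \<odot> y = x1 \<odot> y1 + x0 \<odot> y0" using x y by (simp add: mul_linear)
  moreover have "x1 \<odot> y1 \<in> peirce 1 c" "x0 \<odot> y0 \<in> peirce 0 c"
    using peirce_mult c x y by blast+
  ultimately show ?thesis
    using peirce_imp_even_part[OF c(1)] subspace_add[OF subspace_even_part[OF c(1)]] by auto
qed

lemma even_mult_odd:
  assumes c: "c \<in> V" "c \<odot> c = c" and "x \<in> even_part c" and u: "u \<in> peirce (1/2) c"
  shows "x \<odot> u \<in> peirce (1/2) c"
proof -
  obtain x1 x0 where x: "x1 \<in> peirce 1 c" "x0 \<in> peirce 0 c" "x = x1 + x0"
    using even_part_decomposition[OF c \<open>x \<in> even_part c\<close>] by blast
  note [simp] = c peirceD[OF x(1)] peirceD[OF x(2)] peirceD[OF u]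
  have "x1 \<odot> u \<in> peirce (1/2) c" "x0 \<odot> u \<in> peirce (1/2) c"
    using peirce_mult c x u by blast+
  then show ?thesis using subspace_add[OF subspace_peirce[OF c(1)]] x by (auto simp: mul_linear)
qed

text \<open>Polarisation of \<open>peirce_half_square\<close> at \<open>u + v\<close>.\<close>

lemma odd_mult_odd:
  assumes c: "c \<in> V" "c \<odot> c = c" and u: "u \<in> peirce (1/2) c" and v: "v \<in> peirce (1/2) c"
  shows "u \<odot> v \<in> even_part c"
proof -
  note [simp] = c peirceD[OF u] peirceD[OF v]
  note sq = peirce_half_square[OF c]
  have uv: "u + v \<in> peirce (1/2) c" using subspace_add[OF subspace_peirce[OF c(1)]] u v by auto
  have vu: "v \<odot> u = u \<odot> v" by (rule mul_commute) auto
  have "c \<odot> (c \<odot> (u \<odot> v)) = c \<odot> (u \<odot> v)"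
  proof (rule eq_by_inner)
    fix t show "(c \<odot> (c \<odot> (u \<odot> v))) \<bullet> t = (c \<odot> (u \<odot> v)) \<bullet> t"
      using arg_cong[OF sq[OF uv], of "\<lambda>v. v \<bullet> t"] arg_cong[OF sq[OF u], of "\<lambda>v. v \<bullet> t"]
        arg_cong[OF sq[OF v], of "\<lambda>v. v \<bullet> t"]
      by (simp add: mul_linear vu inner_simps)
  qed
  then show ?thesis by (simp add: even_part_def)
qed

lemma even_odd_decomposition:
  assumes "c \<in> V" "c \<odot> c = c" "z \<in> V"
  shows "\<exists>x\<in>even_part c. \<exists>u\<in>peirce (1/2) c. z = x + u"
proof -
  \<comment> \<open>The polynomial 4 t (1 - t) takes the values 0, 1, 0 at t = 0, 1/2, 1, so in
    multiplication by \<open>c\<close> it gives the projection onto the 1/2-space.\<close>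
  let ?u = "4 *\<^sub>R (c \<odot> z - c \<odot> (c \<odot> z))"
  note [simp] = assms
  have "c \<odot> ?u = (1/2) *\<^sub>R ?u"
    by (rule eq_by_inner) (simp add: mul_linear idempotent_cubic inner_simps field_simps)
  moreover have "c \<odot> (c \<odot> (z - ?u)) = c \<odot> (z - ?u)"
    by (rule eq_by_inner) (simp add: mul_linear idempotent_cubic inner_simps field_simps)
  ultimately have "z - ?u \<in> even_part c" "?u \<in> peirce (1/2) c"
    by (auto simp: even_part_def peirce_def)
  then show ?thesis by (metis diff_add_cancel)
qed

section \<open>Peirce reflections\<close>

text \<open>The polynomial 1 - 8 t + 8 t^2, with values 1, -1, 1 at t = 0, 1/2, 1, in multiplication
  by \<open>c\<close>.\<close>

definition peirce_reflection :: "'a \<Rightarrow> 'a \<Rightarrow> 'a" where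
  "peirce_reflection c z = z - 8 *\<^sub>R (c \<odot> z) + 8 *\<^sub>R (c \<odot> (c \<odot> z))"

lemma peirce_reflection_eq:
  assumes "c \<in> V" "c \<odot> c = c" "x \<in> even_part c" "u \<in> peirce (1/2) c"
  shows "peirce_reflection c (x + u) = x - u"
proof (rule eq_by_inner)
  fix t
  show "peirce_reflection c (x + u) \<bullet> t = (x - u) \<bullet> t"
    using assms by (simp add: peirce_reflection_def even_part_def peirce_def mul_linear inner_simps)
qed

lemma peirce_reflection_Aut:
  assumes c: "c \<in> V" "c \<odot> c = c"
  shows "peirce_reflection c \<in> jordan_Aut V mul"
proof -
  have closed: "peirce_reflection c z \<in> V" if "z \<in> V" for z
    using that c by (simp add: peirce_reflection_def)
  have invol: "peirce_reflection c (peirce_reflection c z) = z" if "z \<in> V" for z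
  proof -
    obtain x u where z: "x \<in> even_part c" "u \<in> peirce (1/2) c" "z = x + u"
      using even_odd_decomposition[OF c \<open>z \<in> V\<close>] by blast
    have "- u \<in> peirce (1/2) c" using subspace_neg[OF subspace_peirce] c z by auto
    from peirce_reflection_eq[OF c z(1) z(2)] peirce_reflection_eq[OF c z(1) this] z(3)
    show ?thesis by simp
  qed
  have mult: "peirce_reflection c (y \<odot> z) = peirce_reflection c y \<odot> peirce_reflection c z"
    if yz: "y \<in> V" "z \<in> V" for y z
  proof -
    obtain x u where y: "x \<in> even_part c" "u \<in> peirce (1/2) c" "y = x + u"
      using even_odd_decomposition[OF c yz(1)] by blast
    obtain w v where z: "w \<in> even_part c" "v \<in> peirce (1/2) c" "z = w + v"
      using even_odd_decomposition[OF c yz(2)] by blast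
    have [simp]: "x \<in> V" "u \<in> V" "w \<in> V" "v \<in> V" using y z by (auto simp: even_part_def peirce_def)
    have "u \<odot> w = w \<odot> u" by (rule mul_commute) auto
    have 1: "x \<odot> w + u \<odot> v \<in> even_part c"
      using even_mult_even odd_mult_odd subspace_add[OF subspace_even_part] c y z by auto
    have 2: "x \<odot> v + w \<odot> u \<in> peirce (1/2) c"
      using even_mult_odd subspace_add[OF subspace_peirce] c y z by auto
    have "y \<odot> z = (x \<odot> w + u \<odot> v) + (x \<odot> v + w \<odot> u)"
      using y z \<open>u \<odot> w = _\<close> by (simp add: mul_linear)
    then have "peirce_reflection c (y \<odot> z) = (x \<odot> w + u \<odot> v) - (x \<odot> v + w \<odot> u)"
      using peirce_reflection_eq[OF c 1 2] by simp
    also have "\<dots> = (x - u) \<odot> (w - v)" using \<open>u \<odot> w = _\<close> by (simp add: mul_linear)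
    finally show ?thesis using peirce_reflection_eq c y z by simp
  qed
  have "bij_betw (peirce_reflection c) V V"
    by (rule bij_betw_byWitness[where f' = "peirce_reflection c"]) (auto simp: invol closed)
  moreover have "peirce_reflection c (x + y) = peirce_reflection c x + peirce_reflection c y"
    if "x \<in> V" "y \<in> V" for x y using that c
    by (simp add: peirce_reflection_def mul_linear algebra_simps)
  moreover have "peirce_reflection c (a *\<^sub>R x) = a *\<^sub>R peirce_reflection c x"
    if "x \<in> V" for x a using that c
    by (simp add: peirce_reflection_def mul_linear algebra_simps)
  ultimately show ?thesis using mult by (simp add: jordan_Aut_def)
qed

section \<open>Primitive idempotents\<close>

text \<open>Lets results about the whole algebra be applied in the corner cut out by
  \<open>c\<close>. The 0-space is covered too, being the corner of the complementary idempotent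
  \<open>e - c\<close>.\<close>

lemma euclidean_jordan_algebra_peirce_1:
  assumes c: "c \<in> V" "c \<odot> c = c"
  shows "euclidean_jordan_algebra (peirce 1 c) mul c"
proof -
  have "x \<odot> y \<in> peirce 1 c" if "x \<in> peirce 1 c" "y \<in> peirce 1 c" for x y
    using peirce_mult[OF c _ that] by simp
  then show ?thesis
    using subspace_peirce[OF c(1), of 1] c
    by unfold_locales
      (auto simp: peirce_def mul_linear jordan_identity inner_associative intro: mul_commute)
qed

lemma idempotent_complement:
  assumes "c \<in> V" "c \<odot> c = c"
  shows "(e - c) \<odot> (e - c) = e - c" "peirce 1 (e - c) = peirce 0 c"
  using assms by (auto simp: mul_linear peirce_def)

lemma idempotent_inner_unit: "c \<in> V \<Longrightarrow> c \<odot> c = c \<Longrightarrow> c \<bullet> e = c \<bullet> c"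
  using inner_associative[of c c e] by (simp add: mul_linear)

lemma idempotent_orthogonal_inner:
  "\<lbrakk>c \<in> V; d \<in> V; c \<odot> c = c; c \<odot> d = 0\<rbrakk> \<Longrightarrow> c \<bullet> d = 0"
  using inner_associative[of c c d] by simp

text \<open>The cross term \<open>2 *\<^sub>R (a \<odot> b)\<close> of the square must vanish. So
  the summands excluded in \<open>primitive_idempotent\<close> are automatically orthogonal.\<close>

lemma idempotent_sum_orthogonal:
  assumes "a \<in> V" "b \<in> V" "a \<odot> a = a" "b \<odot> b = b" "(a + b) \<odot> (a + b) = a + b"
  shows "a \<odot> b = 0"
proof -
  have "b \<odot> a = a \<odot> b" using mul_commute assms by blast
  then have "2 *\<^sub>R (a \<odot> b) = 0"
    using assms by (simp add: mul_linear scaleR_2 algebra_simps)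
  then show ?thesis by simp
qed

section \<open>Existence of idempotents\<close>

text \<open>Outside \<open>V\<close> the product is arbitrary. Precomposing with a linear projection
  onto \<open>V\<close> makes it bilinear on the whole space, hence bounded and continuous.\<close>

lemma mul_extension:
  obtains f :: "'a \<Rightarrow> 'a \<Rightarrow> 'a"
  where "bounded_bilinear f" "\<And>x y. x \<in> V \<Longrightarrow> y \<in> V \<Longrightarrow> f x y = x \<odot> y"
proof -
  have "\<exists>P. linear P \<and> range P \<subseteq> V \<and> (\<forall>x\<in>V. P x = x)"
    using linear_exists_left_inverse_on[of "\<lambda>x::'a. x" V] subspace linear_id
    by (auto simp: id_def inj_on_def)
  then obtain P where P: "linear P" "\<And>x. P x \<in> V" "\<And>x. x \<in> V \<Longrightarrow> P x = x" by blast
  have "bilinear (\<lambda>x y. P x \<odot> P y)"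
    unfolding bilinear_def using P
    by (auto intro!: linearI simp: mul_linear linear_add linear_scale)
  then show ?thesis using that[of "\<lambda>x y. P x \<odot> P y"] P by (simp add: bilinear_conv_bounded_bilinear)
qed

lemma continuous_on_mul:
  assumes "continuous_on S f" "continuous_on S g" "f ` S \<subseteq> V" "g ` S \<subseteq> V"
  shows "continuous_on S (\<lambda>x. f x \<odot> g x)"
proof -
  obtain h where h: "bounded_bilinear h" "\<And>x y. x \<in> V \<Longrightarrow> y \<in> V \<Longrightarrow> h x y = x \<odot> y"
    using mul_extension by blast
  have "continuous_on S (\<lambda>x. h (f x) (g x))"
    by (rule bounded_bilinear.continuous_on[OF h(1) assms(1,2)])
  moreover have "h (f x) (g x) = f x \<odot> g x" if "x \<in> S" for x
    using that assms(3,4) by (intro h(2)) auto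
  ultimately show ?thesis by (simp cong: continuous_on_cong)
qed

text \<open>A maximum of the cubic form on the unit sphere satisfies \<open>a \<odot> a = l *\<^sub>R a\<close>, so \<open>a / l\<close> is an idempotent.\<close>

lemma cubic_form_max_idempotent:
  assumes "V \<noteq> {0}"
  obtains p where "p \<in> V" "p \<odot> p = p" "p \<noteq> 0"
    "\<And>a. a \<in> V \<Longrightarrow> norm a = 1 \<Longrightarrow> (a \<odot> a) \<bullet> a \<le> 1 / norm p"
proof -
  have "e \<noteq> 0"
  proof
    assume "e = 0"
    then have "x = 0" if "x \<in> V" for x using mul_unit[OF that] mul_zero_left[OF that] by simp
    then show False using assms subspace_0[OF subspace] by blast
  qed
  define S where "S = V \<inter> sphere 0 1"
  have S: "a \<in> S \<longleftrightarrow> a \<in> V \<and> norm a = 1" for a by (auto simp: S_def)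
  have "compact S" unfolding S_def
    by (intro closed_Int_compact closed_subspace subspace compact_sphere)
  moreover have unit: "(1 / norm e) *\<^sub>R e \<in> S" using \<open>e \<noteq> 0\<close> by (simp add: S)
  moreover have "continuous_on S (\<lambda>a. (a \<odot> a) \<bullet> a)"
    by (intro continuous_intros continuous_on_mul) (auto simp: S)
  ultimately obtain a where a: "a \<in> S" "\<And>b. b \<in> S \<Longrightarrow> (b \<odot> b) \<bullet> b \<le> (a \<odot> a) \<bullet> a"
    using continuous_attains_sup[of S "\<lambda>a. (a \<odot> a) \<bullet> a"] by blast
  define l where "l = (a \<odot> a) \<bullet> a"
  have [simp]: "a \<in> V" and "norm a = 1" using a by (auto simp: S)
  then have aa: "a \<bullet> a = 1" by (simp add: norm_eq_1)
  have "0 < (1 / norm e) ^ 3 * (e \<bullet> e)" using \<open>e \<noteq> 0\<close> by simp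
  also have "\<dots> \<le> l" using a(2)[OF unit] by (simp add: l_def mul_linear power3_eq_cube)
  finally have "l > 0" .
  have bound: "(b \<odot> b) \<bullet> b \<le> l * norm b ^ 3" if b: "b \<in> V" for b
  proof (cases "b = 0")
    case False
    then have "(1 / norm b) *\<^sub>R b \<in> S" using b by (simp add: S)
    from a(2)[OF this] show ?thesis
      using b False by (simp add: l_def mul_linear field_simps power3_eq_cube)
  qed (simp add: mul_linear)
  \<comment> \<open>Up to the factor 3 this is the tangential gradient of the cubic form at the
    maximum \<open>a\<close>. It is shown to vanish by moving from \<open>a\<close> a small distance
    in direction \<open>h\<close>.\<close>
  define h where "h = a \<odot> a - l *\<^sub>R a"
  have [simp]: "h \<in> V" by (simp add: h_def)
  have ah: "a \<bullet> h = 0" by (simp add: h_def inner_simps aa l_def inner_commute)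
  have "h \<bullet> h = (a \<odot> a - l *\<^sub>R a) \<bullet> h" by (simp only: h_def)
  then have aah: "(a \<odot> a) \<bullet> h = h \<bullet> h" using ah by (simp add: inner_diff_left)
  have "h = 0"
  proof (rule ccontr)
    assume "h \<noteq> 0"
    define g where "g = h \<bullet> h"
    define k where "k = (a \<odot> h) \<bullet> h"
    define m where "m = (h \<odot> h) \<bullet> h"
    \<comment> \<open>The first-order gain is \<open>3 * t * g\<close>. For 0 < t \<le> 1 the
      constant \<open>K\<close> bounds the coefficient of the higher-order terms, and the choice of
      \<open>t\<close> makes \<open>t * K \<le> g\<close>, which is less than
      \<open>3 * g\<close>.\<close>
    define K where "K = 2 * l * g + l * g\<^sup>2 + 3 * \<bar>k\<bar> + \<bar>m\<bar>"
    define t where "t = g / (g + K)"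
    have "g > 0" using \<open>h \<noteq> 0\<close> by (simp add: g_def)
    then have "K \<ge> 0" using \<open>l > 0\<close> by (simp add: K_def)
    then have t: "0 < t" "t \<le> 1" using \<open>g > 0\<close> by (auto simp: t_def)
    have ha: "h \<odot> a = a \<odot> h" by (rule mul_commute) auto
    have k1: "(h \<odot> h) \<bullet> a = k" unfolding k_def ha[symmetric] using inner_associative[of h h a] by (simp add: inner_commute)
    have k2: "(a \<odot> h) \<bullet> a = g" using inner_associative[of a h a] aah by (simp add: inner_commute g_def)
    have f1: "((a + t *\<^sub>R h) \<odot> (a + t *\<^sub>R h)) \<bullet> (a + t *\<^sub>R h) = l + 3 * t * g + 3 * t\<^sup>2 * k + t ^ 3 * m"
      using aah by (simp add: mul_linear ha inner_simps k1 k2 l_def power2_eq_square power3_eq_cube algebra_simps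
         flip: g_def k_def m_def)
    have f2: "((a + t *\<^sub>R h) \<odot> (a + t *\<^sub>R h)) \<bullet> (a + t *\<^sub>R h) \<le> l * norm (a + t *\<^sub>R h) ^ 3"
      by (rule bound) simp
    have n: "(norm (a + t *\<^sub>R h))\<^sup>2 = 1 + t\<^sup>2 * g"
      unfolding power2_norm_eq_inner
      using ah by (simp add: inner_simps aa inner_commute g_def power2_eq_square)
    then have "1 \<le> (norm (a + t *\<^sub>R h))\<^sup>2" using \<open>g > 0\<close> by simp
    then have "1 \<le> norm (a + t *\<^sub>R h)" using power2_le_imp_le[of 1 "norm (a + t *\<^sub>R h)"] by simp
    \<comment> \<open>The norm is at least 1, so its cube may be replaced by the fourth power, which
      is polynomial in \<open>t\<close>.\<close>
    then have "norm (a + t *\<^sub>R h) ^ 3 \<le> norm (a + t *\<^sub>R h) ^ 4" by (intro power_increasing) auto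
    also have "\<dots> = (1 + t\<^sup>2 * g)\<^sup>2" unfolding n[symmetric] by (simp flip: power_mult)
    finally have f3: "l * norm (a + t *\<^sub>R h) ^ 3 \<le> l * (1 + t\<^sup>2 * g)\<^sup>2" using \<open>l > 0\<close> by simp
    from f1 f2 f3 have "l + 3 * t * g + 3 * t\<^sup>2 * k + t ^ 3 * m \<le> l * (1 + t\<^sup>2 * g)\<^sup>2" by linarith
    then have "t * (3 * g) \<le> t * (t * (2 * l * g + l * t\<^sup>2 * g\<^sup>2 - 3 * k - t * m))"
      by (simp add: algebra_simps power2_eq_square power3_eq_cube)
    then have "3 * g \<le> t * (2 * l * g + l * t\<^sup>2 * g\<^sup>2 - 3 * k - t * m)" using t by simp
    also have "\<dots> \<le> t * K"
    proof -
      have "t\<^sup>2 * (l * g\<^sup>2) \<le> 1 * (l * g\<^sup>2)"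
        using t \<open>l > 0\<close> by (intro mult_right_mono) (auto simp: power_le_one)
      moreover have "\<bar>t * m\<bar> \<le> \<bar>m\<bar>" using t by (simp add: abs_mult mult_left_le_one_le)
      ultimately show ?thesis unfolding K_def using t by (intro mult_left_mono) (auto simp: algebra_simps)
    qed
    also have "\<dots> \<le> g" unfolding t_def using \<open>g > 0\<close> \<open>K \<ge> 0\<close> by (simp add: field_simps)
    finally show False using \<open>g > 0\<close> by simp
  qed
  then have sq: "a \<odot> a = l *\<^sub>R a" by (simp add: h_def)
  define p where "p = (1 / l) *\<^sub>R a"
  show ?thesis
  proof
    show "p \<in> V" "p \<odot> p = p" using \<open>l > 0\<close> sq by (auto simp: p_def mul_linear)
    show "p \<noteq> 0" using \<open>l > 0\<close> \<open>norm a = 1\<close> by (auto simp: p_def)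
    fix b assume "b \<in> V" "norm b = 1"
    then show "(b \<odot> b) \<bullet> b \<le> 1 / norm p" using bound[of b] \<open>norm a = 1\<close> \<open>l > 0\<close> by (simp add: p_def)
  qed
qed

text \<open>
  Otherwise some unit vector \<open>h\<close> is orthogonal to \<open>e\<close>, and the cubic form is larger at the normalised sum
  of \<open>e / norm e\<close> and \<open>\<plusminus>h\<close> than at its maximum \<open>e / norm e\<close>.
\<close>

lemma one_dimensional_if_unique_idempotent:
  assumes uniq: "\<And>p. p \<in> V \<Longrightarrow> p \<odot> p = p \<Longrightarrow> p \<noteq> 0 \<Longrightarrow> p = e" and z: "z \<in> V"
  shows "\<exists>r. z = r *\<^sub>R e"
proof (rule ccontr)
  assume no: "\<nexists>r. z = r *\<^sub>R e"
  then have "V \<noteq> {0}" using z by force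
  then obtain p where p: "p \<in> V" "p \<odot> p = p" "p \<noteq> 0"
    "\<And>a. a \<in> V \<Longrightarrow> norm a = 1 \<Longrightarrow> (a \<odot> a) \<bullet> a \<le> 1 / norm p"
    using cubic_form_max_idempotent by blast
  then have "p = e" using uniq by blast
  then have "e \<noteq> 0" using p by simp
  define k where "k = 1 / norm e"
  have "k > 0" using \<open>e \<noteq> 0\<close> by (simp add: k_def)
  have max: "(a \<odot> a) \<bullet> a \<le> k" if "a \<in> V" "norm a = 1" for a
    using p(4)[OF that] \<open>p = e\<close> by (simp add: k_def)
  define g where "g = z - (z \<bullet> e / (e \<bullet> e)) *\<^sub>R e"
  have "g \<noteq> 0" using no by (auto simp: g_def)
  have ge: "e \<bullet> g = 0" using \<open>e \<noteq> 0\<close> by (simp add: g_def inner_simps inner_commute)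
  have [simp]: "g \<in> V" using z by (simp add: g_def)
  \<comment> \<open>Both \<open>g\<close> and \<open>- g\<close> are orthogonal to \<open>e\<close>;
    the sign is chosen so that the cubic form is nonnegative at \<open>h\<close>.\<close>
  define s :: real where "s = (if (g \<odot> g) \<bullet> g \<ge> 0 then 1 else - 1)"
  define h where "h = (s / norm g) *\<^sub>R g"
  have [simp]: "h \<in> V" by (simp add: h_def)
  have hh: "h \<bullet> h = 1"
    using \<open>g \<noteq> 0\<close> by (simp add: h_def s_def power2_norm_eq_inner[symmetric] power2_eq_square)
  have eh: "e \<bullet> h = 0" using ge by (simp add: h_def)
  have hhh: "(h \<odot> h) \<bullet> h \<ge> 0"
  proof -
    have "(h \<odot> h) \<bullet> h = s * ((g \<odot> g) \<bullet> g) / norm g ^ 3"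
      by (simp add: h_def mul_linear s_def power3_eq_cube)
    also have "\<dots> \<ge> 0" by (simp add: s_def)
    finally show ?thesis .
  qed
  have ee: "k * k * (e \<bullet> e) = 1" using \<open>e \<noteq> 0\<close> by (simp add: k_def dot_square_norm power2_eq_square)
  define r :: real where "r = 1 / sqrt 2"
  have rr: "r * r = 1/2" by (simp add: r_def)
  have "r > 1/2"
  proof (rule ccontr)
    assume "\<not> r > 1/2"
    then have "r * r \<le> 1/2 * (1/2)" using rr by (intro mult_mono) (auto simp: r_def)
    then show False using rr by simp
  qed
  define b where "b = r *\<^sub>R (k *\<^sub>R e + h)"
  have [simp]: "b \<in> V" by (simp add: b_def)
  have "b \<bullet> b = r * r * (k * k * (e \<bullet> e) + h \<bullet> h)"
    using eh by (simp add: b_def inner_simps inner_commute algebra_simps)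
  then have "norm b = 1" by (simp add: ee hh rr norm_eq_1)
  \<comment> \<open>The pure term in \<open>e\<close> gives \<open>k\<close> and the three mixed
    terms with \<open>h\<close> twice give \<open>k\<close> each. As r^3 = r / 2 and the pure term
    in \<open>h\<close> is nonnegative, the value is at least 2 r k, which exceeds the maximum
    \<open>k\<close>.\<close>
  have "(b \<odot> b) \<bullet> b = r * (r * r) * (k * (k * k * (e \<bullet> e)) + 3 * k * (h \<bullet> h) + (h \<odot> h) \<bullet> h)"
  proof -
    have "(h \<odot> h) \<bullet> e = h \<bullet> h" using inner_associative[of h h e] by (simp add: mul_linear)
    then show ?thesis using eh by (simp add: b_def mul_linear inner_simps inner_commute algebra_simps)
  qed
  also have "\<dots> = r / 2 * (4 * k + (h \<odot> h) \<bullet> h)" by (simp add: ee hh rr)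
  also have "\<dots> \<ge> r / 2 * (4 * k)" using \<open>r > 1/2\<close> hhh by (intro mult_left_mono) auto
  finally have "2 * r * k \<le> (b \<odot> b) \<bullet> b" by (simp add: ac_simps)
  also have "\<dots> \<le> k" using max[of b] \<open>norm b = 1\<close> by simp
  finally show False using \<open>k > 0\<close> \<open>r > 1/2\<close> by simp
qed

lemma primitive_idempotentD:
  assumes "primitive_idempotent V mul c"
  shows "c \<in> V" "c \<odot> c = c" "c \<noteq> 0" "c \<bullet> c > 0"
  using assms by (auto simp: primitive_idempotent_def jordan_idempotent_def)

text \<open>An idempotent \<open>p\<close> of the corner splits \<open>c\<close> into
  \<open>p\<close> and \<open>c - p\<close>. By primitivity \<open>c\<close> is therefore the only
  nonzero idempotent of the corner, which must be one-dimensional.\<close>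

lemma primitive_peirce_1:
  assumes prim: "primitive_idempotent V mul c" and z: "z \<in> peirce 1 c"
  shows "\<exists>r. z = r *\<^sub>R c"
proof -
  note c = primitive_idempotentD[OF prim]
  interpret sub: euclidean_jordan_algebra "peirce 1 c" mul c
    using c by (intro euclidean_jordan_algebra_peirce_1)
  show ?thesis
  proof (rule sub.one_dimensional_if_unique_idempotent[OF _ z])
    fix p assume p: "p \<in> peirce 1 c" "p \<odot> p = p" "p \<noteq> 0"
    then have pV: "p \<in> V" "c \<odot> p = p" by (auto simp: peirce_def)
    have "p \<odot> c = p" using mul_commute[of c p] pV c by simp
    then have "(c - p) \<odot> (c - p) = c - p" using p pV c by (simp add: mul_linear)
    moreover have "c = p + (c - p)" by simp
    ultimately show "p = c"
      using prim p pV c unfolding primitive_idempotent_def jordan_idempotent_def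
      by (metis V_closed(4) right_minus_eq)
  qed
qed

section \<open>Spectral decomposition\<close>

text \<open>Multiplication by \<open>c\<close> is self-adjoint, so its eigenspaces are
  orthogonal.\<close>

lemma peirce_orthogonal:
  assumes "c \<in> V" "y \<in> peirce a c" "z \<in> peirce b c" "a \<noteq> b"
  shows "y \<bullet> z = 0"
  using inner_associative[of c y z] assms by (auto simp: peirce_def)

text \<open>
  That \<open>q\<close> is idempotent comes from the Jordan identity for \<open>x = u\<close> at \<open>y = p\<close> and at \<open>y = u\<close>. The span of
  \<open>p\<close>, \<open>q\<close>, \<open>u\<close> is then a copy of the symmetric 2-by-2 matrices.
\<close>

lemma peirce_half_square_primitive:
  assumes prim: "primitive_idempotent V mul p" and u: "u \<in> peirce (1/2) p" "u \<noteq> 0"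
  obtains q \<alpha> where "\<alpha> > 0" "q \<in> V" "q \<odot> q = q" "p \<odot> q = 0" "q \<odot> u = (1/2) *\<^sub>R u"
    "u \<odot> u = \<alpha> *\<^sub>R (p + q)" "q \<bullet> q = p \<bullet> p"
proof -
  note p = primitive_idempotentD[OF prim]
  note [simp] = p(1,2) peirceD[OF u(1)]
  obtain x z where xz: "x \<in> peirce 1 p" "z \<in> peirce 0 p" "u \<odot> u = x + z"
    using even_part_decomposition[OF p(1,2) odd_mult_odd[OF p(1,2) u(1) u(1)]] by blast
  obtain \<alpha> where x: "x = \<alpha> *\<^sub>R p" using primitive_peirce_1[OF prim xz(1)] by blast
  have [simp]: "z \<in> V" "p \<odot> z = 0" using peirceD[OF xz(2)] by auto
  have comm: "z \<odot> p = 0" "u \<odot> p = (1/2) *\<^sub>R u"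
    using mul_commute[of z p] mul_commute[of u p] by auto
  have uu: "u \<odot> u = \<alpha> *\<^sub>R p + z" using xz x by simp
  have "p \<bullet> z = 0" using peirce_orthogonal[OF p(1) _ xz(2), of p 1] by (simp add: peirce_def)
  then have "\<alpha> * (p \<bullet> p) = (u \<odot> u) \<bullet> p" by (simp add: uu inner_simps inner_commute)
  also have up: "\<dots> = u \<bullet> u / 2" using inner_associative[of u u p] by (simp add: comm)
  finally have \<alpha>uu: "\<alpha> * (p \<bullet> p) = u \<bullet> u / 2" .
  have "\<alpha> > 0"
  proof (rule ccontr)
    assume "\<not> \<alpha> > 0"
    then have "\<alpha> * (p \<bullet> p) \<le> 0" by (simp add: mult_nonpos_nonneg)
    moreover have "u \<bullet> u > 0" using u(2) by simp
    ultimately show False using \<alpha>uu by linarith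
  qed
  have "u \<odot> ((u \<odot> u) \<odot> p) = (u \<odot> u) \<odot> (u \<odot> p)" by (rule jordan_identity) auto
  then have "(\<alpha> / 2) *\<^sub>R u = (1/2) *\<^sub>R ((u \<odot> u) \<odot> u)"
    by (simp add: uu comm mul_linear)
  then have "2 *\<^sub>R ((\<alpha> / 2) *\<^sub>R u) = 2 *\<^sub>R ((1/2) *\<^sub>R ((u \<odot> u) \<odot> u))" by (rule arg_cong)
  then have uuu: "(u \<odot> u) \<odot> u = \<alpha> *\<^sub>R u" by simp
  have zu: "z \<odot> u = (\<alpha> / 2) *\<^sub>R u"
  proof (rule eq_by_inner)
    fix t show "(z \<odot> u) \<bullet> t = ((\<alpha> / 2) *\<^sub>R u) \<bullet> t"
      using arg_cong[OF uuu, of "\<lambda>v. v \<bullet> t"] by (simp add: uu mul_linear inner_simps)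
  qed
  have "u \<odot> ((u \<odot> u) \<odot> u) = (u \<odot> u) \<odot> (u \<odot> u)" by (rule jordan_identity) auto
  then have "\<alpha> *\<^sub>R (u \<odot> u) = (u \<odot> u) \<odot> (u \<odot> u)" by (simp add: uuu mul_linear)
  then have zz: "z \<odot> z = \<alpha> *\<^sub>R z"
    by (simp add: uu mul_linear comm algebra_simps)
  define q where "q = (1 / \<alpha>) *\<^sub>R z"
  have uq: "u \<odot> q = (1/2) *\<^sub>R u"
    using mul_commute[of u z] \<open>\<alpha> > 0\<close> zu by (simp add: q_def mul_linear)
  show ?thesis
  proof
    show "\<alpha> > 0" by fact
    show q: "q \<in> V" "q \<odot> q = q" "p \<odot> q = 0" "q \<odot> u = (1/2) *\<^sub>R u"
      using \<open>\<alpha> > 0\<close> zz zu by (auto simp: q_def mul_linear)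
    show sq: "u \<odot> u = \<alpha> *\<^sub>R (p + q)"
      using \<open>\<alpha> > 0\<close> by (simp add: q_def uu algebra_simps)
    have "\<alpha> * (q \<bullet> q) = (u \<odot> u) \<bullet> q"
      using idempotent_orthogonal_inner[of p q] q by (simp add: sq inner_simps inner_commute)
    also have "\<dots> = u \<bullet> u / 2" using inner_associative[of u u q] uq q by simp
    finally show "q \<bullet> q = p \<bullet> p" using \<alpha>uu \<open>\<alpha> > 0\<close> by (metis less_irrefl mult_left_cancel)
  qed
qed

text \<open>Idempotents satisfy |c|^2 = <c, e>, so |c| \<le> |e| by Cauchy-Schwarz. If B bounds the
  product, |c| \<le> B |c|^2 keeps the nonzero ones away from 0, so that excluding 0 leaves a closed
  set.\<close>

lemma compact_nonzero_idempotents: "compact {c \<in> V. c \<odot> c = c \<and> c \<noteq> 0}"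
proof -
  obtain h where h: "bounded_bilinear h" "\<And>x y. x \<in> V \<Longrightarrow> y \<in> V \<Longrightarrow> h x y = x \<odot> y"
    using mul_extension by blast
  obtain B where B: "B > 0" "\<And>x y. norm (h x y) \<le> norm x * norm y * B"
    using bounded_bilinear.pos_bounded[OF h(1)] by blast
  have ge: "1 / B \<le> norm c" if "c \<in> V" "c \<odot> c = c" "c \<noteq> 0" for c
  proof -
    have "norm c * 1 \<le> norm c * (norm c * B)" using B(2)[of c c] h(2)[of c c] that by (simp add: mult.assoc)
    then have "1 \<le> norm c * B" using that by simp
    then show ?thesis using B by (simp add: field_simps)
  qed
  have le: "norm c \<le> norm e" if "c \<in> V" "c \<odot> c = c" for c
  proof (cases "c = 0")
    case False
    have "norm c * norm c = c \<bullet> e"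
      using idempotent_inner_unit[OF that] by (simp add: norm_eq_sqrt_inner)
    also have "\<dots> \<le> norm c * norm e" by (rule norm_cauchy_schwarz)
    finally show ?thesis using False by simp
  qed simp
  have "{c \<in> V. c \<odot> c = c \<and> c \<noteq> 0} = (V \<inter> {c. h c c = c} \<inter> {c. 1 / B \<le> norm c}) \<inter> cball 0 (norm e)"
  proof (intro set_eqI iffI)
    fix c assume "c \<in> {c \<in> V. c \<odot> c = c \<and> c \<noteq> 0}"
    then show "c \<in> (V \<inter> {c. h c c = c} \<inter> {c. 1 / B \<le> norm c}) \<inter> cball 0 (norm e)"
      using ge[of c] le[of c] h(2) by simp
  next
    fix c assume c: "c \<in> (V \<inter> {c. h c c = c} \<inter> {c. 1 / B \<le> norm c}) \<inter> cball 0 (norm e)"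
    then have "c \<noteq> 0" using B by auto
    then show "c \<in> {c \<in> V. c \<odot> c = c \<and> c \<noteq> 0}" using c h(2)[of c c] by simp
  qed
  moreover have "closed {c. h c c = c}" "closed {c::'a. 1 / B \<le> norm c}"
    by (intro closed_Collect_eq closed_Collect_le continuous_intros bounded_bilinear.continuous_on[OF h(1)])+
  then have "closed (V \<inter> {c. h c c = c} \<inter> {c. 1 / B \<le> norm c})"
    using closed_subspace[OF subspace] by (intro closed_Int) auto
  ultimately show ?thesis using closed_Int_compact compact_cball by metis
qed

text \<open>Among the maximisers of the quotient, one of least norm is taken. If it were a sum
  \<open>a + b\<close> of nonzero idempotents, equality for the sum would force equality for both,
  and \<open>a\<close> would be a shorter maximiser.\<close>

lemma exists_primitive_maximizer:
  assumes "V \<noteq> {0}" and x: "x \<in> V"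
  obtains p M where "primitive_idempotent V mul p" "x \<bullet> p = M * (p \<bullet> p)"
    "\<And>c. c \<in> V \<Longrightarrow> c \<odot> c = c \<Longrightarrow> x \<bullet> c \<le> M * (c \<bullet> c)"
proof -
  define K where "K = {c \<in> V. c \<odot> c = c \<and> c \<noteq> 0}"
  have "compact K" using compact_nonzero_idempotents by (simp add: K_def)
  moreover have "K \<noteq> {}" using cubic_form_max_idempotent[OF assms(1)] by (auto simp: K_def)
  moreover have "continuous_on K (\<lambda>c. x \<bullet> c / (c \<bullet> c))"
    by (intro continuous_intros) (auto simp: K_def)
  ultimately obtain d where d: "d \<in> K" "\<And>c. c \<in> K \<Longrightarrow> x \<bullet> c / (c \<bullet> c) \<le> x \<bullet> d / (d \<bullet> d)"
    using continuous_attains_sup[of K "\<lambda>c. x \<bullet> c / (c \<bullet> c)"] by blast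
  define M where "M = x \<bullet> d / (d \<bullet> d)"
  have M: "x \<bullet> c \<le> M * (c \<bullet> c)" if "c \<in> V" "c \<odot> c = c" for c
  proof (cases "c = 0")
    case False
    then show ?thesis using d(2)[of c] that by (simp add: K_def M_def[symmetric] pos_divide_le_eq)
  qed simp
  define K' where "K' = K \<inter> {c. x \<bullet> c = M * (c \<bullet> c)}"
  have "closed {c. x \<bullet> c = M * (c \<bullet> c)}" by (intro closed_Collect_eq continuous_intros)
  then have "compact K'" unfolding K'_def using \<open>compact K\<close> by (intro compact_Int_closed)
  moreover have "d \<in> K'" using d by (simp add: K'_def K_def M_def)
  then have "K' \<noteq> {}" by blast
  moreover have "continuous_on K' (\<lambda>c. c \<bullet> c)" by (intro continuous_intros)
  ultimately obtain p where p: "p \<in> K'" "\<And>c. c \<in> K' \<Longrightarrow> p \<bullet> p \<le> c \<bullet> c"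
    using continuous_attains_inf[of K' "\<lambda>c. c \<bullet> c"] by blast
  have pV: "p \<in> V" "p \<odot> p = p" "p \<noteq> 0" "x \<bullet> p = M * (p \<bullet> p)" using p by (auto simp: K'_def K_def)
  have "primitive_idempotent V mul p"
    unfolding primitive_idempotent_def jordan_idempotent_def
  proof (intro conjI notI)
    assume "\<exists>a b. (a \<in> V \<and> a \<odot> a = a) \<and> a \<noteq> 0 \<and> (b \<in> V \<and> b \<odot> b = b) \<and> b \<noteq> 0 \<and> p = a + b"
    then obtain a b where ab: "a \<in> V" "a \<odot> a = a" "a \<noteq> 0" "b \<in> V" "b \<odot> b = b" "b \<noteq> 0" "p = a + b"
      by blast
    then have "a \<bullet> b = 0" using pV idempotent_sum_orthogonal idempotent_orthogonal_inner by blast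
    then have pp: "p \<bullet> p = a \<bullet> a + b \<bullet> b" using ab by (simp add: inner_simps inner_commute)
    have "x \<bullet> a = M * (a \<bullet> a)"
      using M[of a] M[of b] ab pV(4) unfolding pp by (simp add: inner_simps algebra_simps)
    then have "a \<in> K'" using ab by (simp add: K'_def K_def)
    then have "b \<bullet> b \<le> 0" using p(2)[of a] pp by simp
    moreover have "b \<bullet> b > 0" using ab by simp
    ultimately show False by linarith
  qed (use pV in auto)
  then show ?thesis using that pV(4) M by blast
qed

text \<open>
  A nonzero Peirce 1/2-component of \<open>x\<close> would allow rotating the maximiser \<open>p\<close> into the better idempotents
  \<open>(p + t w + t\<^sup>2 q) / (1 + t\<^sup>2)\<close>.
\<close>

lemma primitive_splitting:
  assumes "V \<noteq> {0}" and x: "x \<in> V"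
  obtains p r y where "primitive_idempotent V mul p" "y \<in> peirce 0 p" "x = r *\<^sub>R p + y"
proof -
  obtain p M where prim: "primitive_idempotent V mul p" and M: "x \<bullet> p = M * (p \<bullet> p)"
    "\<And>c. c \<in> V \<Longrightarrow> c \<odot> c = c \<Longrightarrow> x \<bullet> c \<le> M * (c \<bullet> c)"
    using exists_primitive_maximizer[OF assms] by blast
  note p = primitive_idempotentD[OF prim]
  obtain v u where "v \<in> even_part p" and u: "u \<in> peirce (1/2) p" and xvu: "x = v + u"
    using even_odd_decomposition[OF p(1,2) x] by blast
  then obtain x1 y where x1: "x1 \<in> peirce 1 p" and y: "y \<in> peirce 0 p" and v: "v = x1 + y"
    using even_part_decomposition[OF p(1,2)] by blast
  have "u = 0"
  proof (rule ccontr)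
    assume "u \<noteq> 0"
    then obtain q \<alpha> where q: "\<alpha> > 0" "q \<in> V" "q \<odot> q = q" "p \<odot> q = 0" "q \<odot> u = (1/2) *\<^sub>R u"
      "u \<odot> u = \<alpha> *\<^sub>R (p + q)" "q \<bullet> q = p \<bullet> p"
      using peirce_half_square_primitive[OF prim u] by metis
    \<comment> \<open>Scaled so that \<open>w \<odot> w = p + q\<close>; then \<open>p\<close>,
      \<open>q\<close>, \<open>w\<close> multiply like the symmetric matrices E11, E22 and E12 +
      E21.\<close>
    define w where "w = (1 / sqrt \<alpha>) *\<^sub>R u"
    have [simp]: "u \<in> V" "w \<in> V" "p \<in> V" "q \<in> V" using u q p by (auto simp: peirce_def w_def)
    have pw: "p \<odot> w = (1/2) *\<^sub>R w" using peirceD(2)[OF u] by (simp add: w_def mul_linear)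
    have qw: "q \<odot> w = (1/2) *\<^sub>R w" using q by (simp add: w_def mul_linear)
    have ww: "w \<odot> w = p + q" using q by (simp add: w_def mul_linear)
    have comm: "w \<odot> p = (1/2) *\<^sub>R w" "w \<odot> q = (1/2) *\<^sub>R w" "q \<odot> p = 0"
      using mul_commute[of w p] mul_commute[of w q] mul_commute[of q p] pw qw q by auto
    have "p \<bullet> w = 0"
      using inner_associative[of p p w] pw p by simp
    then have we: "w \<bullet> e = 0"
      using inner_associative[of p w e] pw by (simp add: mul_linear inner_commute)
    have "x1 \<bullet> u = 0" "y \<bullet> u = 0"
      using peirce_orthogonal[OF p(1) x1 u] peirce_orthogonal[OF p(1) y u] by auto
    then have "x \<bullet> w = u \<bullet> u / sqrt \<alpha>" by (simp add: xvu v w_def inner_simps)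
    then have xw: "x \<bullet> w > 0" using \<open>u \<noteq> 0\<close> q by simp
    have step: "x \<bullet> w \<le> t * (M * (p \<bullet> p) - x \<bullet> q)" if "t > 0" for t
    proof -
      define s where "s = 1 / (1 + t\<^sup>2)"
      have "1 + t\<^sup>2 > 0" by (simp add: add_pos_nonneg)
      then have s: "s * (1 + t\<^sup>2) = 1" "s > 0" by (auto simp: s_def)
      \<comment> \<open>In the matrix picture \<open>d\<close> is the rank-one matrix of the vector
        (1, t), and \<open>s *\<^sub>R d\<close> is the projection onto that vector; it has the same
        norm as \<open>p\<close>.\<close>
      define d where "d = p + t *\<^sub>R w + t\<^sup>2 *\<^sub>R q"
      have [simp]: "d \<in> V" by (simp add: d_def)
      have dd: "d \<odot> d = (1 + t\<^sup>2) *\<^sub>R d"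
      proof (rule eq_by_inner)
        fix z show "(d \<odot> d) \<bullet> z = ((1 + t\<^sup>2) *\<^sub>R d) \<bullet> z"
          using p q pw qw ww comm
          by (simp add: d_def mul_linear inner_simps algebra_simps power2_eq_square)
      qed
      have idem: "(s *\<^sub>R d) \<odot> (s *\<^sub>R d) = s *\<^sub>R d" using s dd by (simp add: mul_linear)
      have "s *\<^sub>R d \<bullet> s *\<^sub>R d = s *\<^sub>R d \<bullet> e"
        using idempotent_inner_unit[of "s *\<^sub>R d"] idem by (metis V_closed(5) \<open>d \<in> V\<close>)
      also have "\<dots> = s * (1 + t\<^sup>2) * (p \<bullet> p)"
        using idempotent_inner_unit[of p] idempotent_inner_unit[of q] p q we
        by (simp add: d_def inner_simps algebra_simps)
      finally have "s *\<^sub>R d \<bullet> s *\<^sub>R d = p \<bullet> p" using s by simp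
      then have "s * (x \<bullet> d) \<le> (s * (1 + t\<^sup>2)) * (M * (p \<bullet> p))" using M(2)[of "s *\<^sub>R d"] idem s by simp
      then have "s * (x \<bullet> d) \<le> s * ((1 + t\<^sup>2) * (M * (p \<bullet> p)))" by (simp only: mult.assoc)
      then have "x \<bullet> d \<le> (1 + t\<^sup>2) * (M * (p \<bullet> p))" using s by simp
      then have "t * (x \<bullet> w) \<le> t * (t * (M * (p \<bullet> p) - x \<bullet> q))"
        using M(1) by (simp add: d_def inner_simps algebra_simps power2_eq_square)
      then show ?thesis using that by simp
    qed
    define k where "k = M * (p \<bullet> p) - x \<bullet> q"
    \<comment> \<open>The right-hand side of \<open>step\<close> tends to 0 with \<open>t\<close>,
      while \<open>x \<bullet> w\<close> is a positive constant; this value of \<open>t\<close> is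
      already small enough.\<close>
    have "x \<bullet> w \<le> (x \<bullet> w) / (\<bar>k\<bar> + 1) * k"
      using step[of "(x \<bullet> w) / (\<bar>k\<bar> + 1)"] xw by (simp add: k_def)
    also have "\<dots> = (x \<bullet> w) * (k / (\<bar>k\<bar> + 1))" by simp
    also have "\<dots> < (x \<bullet> w) * 1"
      using xw by (intro mult_strict_left_mono) (auto simp: divide_less_eq)
    finally show False by simp
  qed
  moreover obtain r where "x1 = r *\<^sub>R p" using primitive_peirce_1[OF prim x1] by blast
  ultimately show ?thesis using that[OF prim y, of r] xvu v by simp
qed

text \<open>Summands of \<open>c\<close> in \<open>V\<close> lie in the 1-space of \<open>c\<close>,
  whereas \<open>p\<close> lies in its 0-space. Hence they are annihilated by \<open>p\<close>, and
  any splitting of \<open>c\<close> takes place inside the corner already.\<close>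

lemma primitive_idempotent_peirce_0_lift:
  assumes p: "p \<in> V" "p \<odot> p = p" and c: "primitive_idempotent (peirce 0 p) mul c"
  shows "primitive_idempotent V mul c"
proof -
  have cV: "c \<in> peirce 0 p" "c \<in> V" "c \<odot> c = c" "c \<noteq> 0"
    using c by (auto simp: primitive_idempotent_def jordan_idempotent_def peirce_def)
  have "p \<in> peirce 0 c" using cV p mul_commute[of p c] by (simp add: peirce_def)
  have part: "a \<in> peirce 0 p"
    if ab: "a \<in> V" "a \<odot> a = a" "b \<in> V" "b \<odot> b = b" "c = a + b" for a b
  proof -
    have "a \<odot> b = 0" using idempotent_sum_orthogonal[of a b] ab cV by simp
    then have "b \<odot> a = 0" using mul_commute[of a b] ab by simp
    then have "a \<in> peirce 1 c" using ab by (simp add: peirce_def mul_linear)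
    then have "a \<odot> p = 0" using peirce_10 cV \<open>p \<in> peirce 0 c\<close> by blast
    then show ?thesis using ab p mul_commute[of a p] by (simp add: peirce_def)
  qed
  show ?thesis
    unfolding primitive_idempotent_def jordan_idempotent_def
  proof (intro conjI notI)
    assume "\<exists>a b. (a \<in> V \<and> a \<odot> a = a) \<and> a \<noteq> 0 \<and> (b \<in> V \<and> b \<odot> b = b) \<and> b \<noteq> 0 \<and> c = a + b"
    then obtain a b where ab: "a \<in> V" "a \<odot> a = a" "a \<noteq> 0" "b \<in> V" "b \<odot> b = b" "b \<noteq> 0" "c = a + b"
      by blast
    then have "a \<in> peirce 0 p" "b \<in> peirce 0 p" using part[of a b] part[of b a] by (auto simp: add.commute)
    then show False
      using c ab unfolding primitive_idempotent_def jordan_idempotent_def by blast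
  qed (use cV in auto)
qed

end

lemma (in euclidean_jordan_algebra) jordan_frameD:
  assumes "jordan_frame V mul e F"
  shows "finite F" "\<And>c. c \<in> F \<Longrightarrow> primitive_idempotent V mul c" "\<And>c. c \<in> F \<Longrightarrow> c \<in> V"
    "\<And>c. c \<in> F \<Longrightarrow> c \<odot> c = c" "\<And>c. c \<in> F \<Longrightarrow> c \<noteq> 0" "\<And>c. c \<in> F \<Longrightarrow> c \<bullet> c > 0"
    "\<And>c d. c \<in> F \<Longrightarrow> d \<in> F \<Longrightarrow> c \<noteq> d \<Longrightarrow> c \<odot> d = 0" "\<Sum>F = e"
  using assms primitive_idempotentD unfolding jordan_frame_def by blast+

text \<open>Induction on the dimension: \<open>primitive_splitting\<close> removes one primitive
  \<open>p\<close>, and the rest of \<open>x\<close> lies in the smaller algebra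
  \<open>peirce 0 p\<close> with unit \<open>e - p\<close>. The algebra and its unit vary in the
  induction, so the statement stands outside the locale.\<close>

lemma spectral_decomposition_exists:
  assumes "euclidean_jordan_algebra V mul e" "x \<in> V"
  shows "\<exists>F l. jordan_frame V mul e F \<and> x = (\<Sum>c\<in>F. l c *\<^sub>R c)"
  using assms
proof (induction "dim V" arbitrary: V e x rule: less_induct)
  case less
  interpret euclidean_jordan_algebra V mul e by fact
  show ?case
  proof (cases "V = {0}")
    case True
    then have "jordan_frame V mul e {}" "x = 0" using unit_closed less.prems by (auto simp: jordan_frame_def)
    then show ?thesis by force
  next
    case False
    obtain p r y where prim: "primitive_idempotent V mul p" and y: "y \<in> peirce 0 p" "x = r *\<^sub>R p + y"
      using primitive_splitting[OF False less.prems(2)] by blast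
    note p = primitive_idempotentD[OF prim]
    have sub: "euclidean_jordan_algebra (peirce 0 p) mul (e - p)"
      using euclidean_jordan_algebra_peirce_1[of "e - p"] idempotent_complement[of p] p by simp
    have "p \<notin> peirce 0 p" using p by (simp add: peirce_def)
    then have "peirce 0 p \<subset> V" using p(1) peirceD(1) by blast
    then have "dim (peirce 0 p) < dim V"
      using subspace subspace_peirce[OF p(1)] by (intro dim_psubset) (simp add: span_eq_iff[THEN iffD2])
    from less.hyps[OF this sub y(1)] obtain F l
      where F: "jordan_frame (peirce 0 p) mul (e - p) F" and l: "y = (\<Sum>c\<in>F. l c *\<^sub>R c)" by blast
    interpret sub: euclidean_jordan_algebra "peirce 0 p" mul "e - p" by (rule sub)
    note F = sub.jordan_frameD[OF F]
    have "p \<notin> F" using F(3) \<open>p \<notin> peirce 0 p\<close> by blast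
    have F0: "p \<odot> c = 0" "c \<odot> p = 0" if "c \<in> F" for c
      using F(3)[OF that] p(1) mul_commute[of c p] by (auto simp: peirce_def)
    have "jordan_frame V mul e (insert p F)"
      unfolding jordan_frame_def
    proof (intro conjI ballI impI)
      show "primitive_idempotent V mul c" if "c \<in> insert p F" for c
        using that prim F(2) primitive_idempotent_peirce_0_lift[OF p(1,2)] by blast
      show "c \<odot> d = 0" if "c \<in> insert p F" "d \<in> insert p F" "c \<noteq> d" for c d
        using that F(7) F0 by blast
    qed (use F(1,8) \<open>p \<notin> F\<close> in auto)
    moreover have "x = (\<Sum>c\<in>insert p F. (l(p := r)) c *\<^sub>R c)"
    proof -
      have "(\<Sum>c\<in>F. (l(p := r)) c *\<^sub>R c) = y" unfolding l using \<open>p \<notin> F\<close> by (intro sum.cong) auto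
      then show ?thesis using F(1) \<open>p \<notin> F\<close> y by simp
    qed
    ultimately show ?thesis by blast
  qed
qed

section \<open>Conjugacy of Jordan frames\<close>

context euclidean_jordan_algebra
begin

section \<open>Automorphisms and their action on frames\<close>

lemma jordan_AutD:
  assumes "A \<in> jordan_Aut V mul"
  shows "bij_betw A V V" "\<And>x. x \<in> V \<Longrightarrow> A x \<in> V"
    "\<And>x y. x \<in> V \<Longrightarrow> y \<in> V \<Longrightarrow> A (x + y) = A x + A y"
    "\<And>a x. x \<in> V \<Longrightarrow> A (a *\<^sub>R x) = a *\<^sub>R A x"
    "\<And>x y. x \<in> V \<Longrightarrow> y \<in> V \<Longrightarrow> A (x \<odot> y) = A x \<odot> A y"
    "inj_on A V" "\<And>y. y \<in> V \<Longrightarrow> \<exists>x\<in>V. A x = y"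
  using assms by (auto simp: jordan_Aut_def bij_betw_def) (metis imageE)

lemma jordan_Aut_id: "(\<lambda>x. x) \<in> jordan_Aut V mul"
  by (auto simp: jordan_Aut_def bij_betw_def)

lemma jordan_Aut_comp:
  assumes "A \<in> jordan_Aut V mul" "B \<in> jordan_Aut V mul"
  shows "A \<circ> B \<in> jordan_Aut V mul"
  using jordan_AutD[OF assms(1)] jordan_AutD[OF assms(2)]
  by (auto simp: jordan_Aut_def intro: bij_betw_trans)

lemma jordan_Aut_inverse:
  assumes "A \<in> jordan_Aut V mul"
  obtains B where "B \<in> jordan_Aut V mul" "\<And>x. x \<in> V \<Longrightarrow> A (B x) = x" "\<And>x. x \<in> V \<Longrightarrow> B (A x) = x"
proof
  note A = jordan_AutD[OF assms]
  let ?B = "inv_into V A"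
  show r: "A (?B x) = x" if "x \<in> V" for x using bij_betw_inv_into_right A(1) that by fastforce
  show l: "?B (A x) = x" if "x \<in> V" for x using bij_betw_inv_into_left A(1) that by fastforce
  have bij: "bij_betw ?B V V" by (rule bij_betw_inv_into[OF A(1)])
  then have [simp]: "?B x \<in> V" if "x \<in> V" for x using that bij_betwE by blast
  have "?B (x + y) = ?B x + ?B y" "?B (x \<odot> y) = ?B x \<odot> ?B y" if "x \<in> V" "y \<in> V" for x y
    using that l[of "?B x + ?B y"] l[of "?B x \<odot> ?B y"] by (simp_all add: A r)
  moreover have "?B (a *\<^sub>R x) = a *\<^sub>R ?B x" if "x \<in> V" for a x
    using that l[of "a *\<^sub>R ?B x"] by (simp add: A r)
  ultimately show "?B \<in> jordan_Aut V mul" using bij by (simp add: jordan_Aut_def)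
qed

lemma jordan_Aut_zero: "A \<in> jordan_Aut V mul \<Longrightarrow> A 0 = 0"
  using jordan_AutD(4)[of A 0 0] by simp

lemma jordan_Aut_sum:
  assumes "A \<in> jordan_Aut V mul" "\<And>i. i \<in> I \<Longrightarrow> f i \<in> V"
  shows "A (sum f I) = (\<Sum>i\<in>I. A (f i))"
  using assms(2)
  by (induction I rule: infinite_finite_induct) (auto simp: jordan_Aut_zero[OF assms(1)] jordan_AutD(3)[OF assms(1)])

lemma jordan_Aut_unit:
  assumes "A \<in> jordan_Aut V mul"
  shows "A e = e"
proof -
  note A = jordan_AutD[OF assms]
  obtain x where x: "x \<in> V" "A x = e" using A(7)[OF unit_closed] by blast
  have "A e = A e \<odot> A x" using A(2) x by (simp add: mul_linear)
  also have "\<dots> = A (e \<odot> x)" using A(5) x by simp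
  finally show ?thesis using x by (simp add: mul_linear)
qed

lemma jordan_Aut_primitive:
  assumes "A \<in> jordan_Aut V mul" "primitive_idempotent V mul c"
  shows "primitive_idempotent V mul (A c)"
proof -
  note A = jordan_AutD[OF assms(1)]
  note c = primitive_idempotentD[OF assms(2)]
  obtain B where B: "B \<in> jordan_Aut V mul" "\<And>x. x \<in> V \<Longrightarrow> A (B x) = x" "\<And>x. x \<in> V \<Longrightarrow> B (A x) = x"
    using jordan_Aut_inverse[OF assms(1)] by blast
  note B' = jordan_AutD[OF B(1)]
  show ?thesis
    unfolding primitive_idempotent_def jordan_idempotent_def
  proof (intro conjI notI)
    show "A c \<in> V" "A c \<odot> A c = A c" using A c by (auto simp flip: A(5))
    show False if "A c = 0" using B(3)[OF c(1)] that jordan_Aut_zero[OF B(1)] c by simp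
    assume "\<exists>a b. (a \<in> V \<and> a \<odot> a = a) \<and> a \<noteq> 0 \<and> (b \<in> V \<and> b \<odot> b = b) \<and> b \<noteq> 0 \<and> A c = a + b"
    then obtain a b where ab: "a \<in> V" "a \<odot> a = a" "a \<noteq> 0" "b \<in> V" "b \<odot> b = b" "b \<noteq> 0" "A c = a + b"
      by blast
    have "c = B a + B b" using ab B(3)[OF c(1)] B'(3) by simp
    moreover have "B a \<odot> B a = B a" "B b \<odot> B b = B b" using ab B'(5) by metis+
    moreover have "B a \<noteq> 0" "B b \<noteq> 0" using ab B(2) jordan_Aut_zero[OF assms(1)] by metis+
    ultimately show False
      using assms(2) ab B'(2) unfolding primitive_idempotent_def jordan_idempotent_def by blast
  qed
qed

lemma jordan_Aut_frame:
  assumes A: "A \<in> jordan_Aut V mul" and F: "jordan_frame V mul e F"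
  shows "jordan_frame V mul e (A ` F)"
  unfolding jordan_frame_def
proof (intro conjI ballI impI)
  note F = jordan_frameD[OF F] and A' = jordan_AutD[OF A]
  show "finite (A ` F)" using F by blast
  show "primitive_idempotent V mul c" if "c \<in> A ` F" for c using that F jordan_Aut_primitive[OF A] by blast
  show "c \<odot> d = 0" if cd: "c \<in> A ` F" "d \<in> A ` F" "c \<noteq> d" for c d
  proof -
    from cd obtain c' d' where "c' \<in> F" "d' \<in> F" "c = A c'" "d = A d'" "c' \<noteq> d'" by blast
    then show ?thesis using F(3,7) A'(5) jordan_Aut_zero[OF A] by metis
  qed
  have "inj_on A F" using A'(6) F(3) by (meson inj_on_subset subsetI)
  then have "\<Sum>(A ` F) = A (\<Sum>F)" using jordan_Aut_sum[OF A, of F "\<lambda>x. x"] F(3) by (simp add: sum.reindex)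
  then show "\<Sum>(A ` F) = e" using F(8) jordan_Aut_unit[OF A] by simp
qed

section \<open>Exchanging two primitive idempotents\<close>

text \<open>The model: \<open>c\<close> and \<open>d\<close> are the projections onto unit vectors a
  and b with inner product \<open>s\<close>, and \<open>w\<close> is (a b^T + b a^T) / 2. Then
  \<open>p\<close> is the projection onto a + b, whose squared length is 2 + 2s, and its reflection
  exchanges a and b. The vector \<open>w\<close> is a separate argument because
  \<open>c \<odot> d\<close> does not determine it when s = 0.\<close>

lemma peirce_reflection_swap:
  assumes [simp]: "c \<in> V" "d \<in> V" "w \<in> V" and "c \<odot> c = c" "d \<odot> d = d" "s \<ge> 0"
    and cd: "c \<odot> d = s *\<^sub>R w" and cw: "c \<odot> w = (1/2) *\<^sub>R (w + s *\<^sub>R c)"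
    and dw: "d \<odot> w = (1/2) *\<^sub>R (w + s *\<^sub>R d)"
    and ww: "w \<odot> w = (1/4) *\<^sub>R (c + d + (2 * s) *\<^sub>R w)"
  defines "p \<equiv> (1 / (2 + 2 * s)) *\<^sub>R (c + d + 2 *\<^sub>R w)"
  shows "p \<in> V" "p \<odot> p = p" "peirce_reflection p c = d"
proof -
  define k where "k = 1 / (2 + 2 * s)"
  \<comment> \<open>Used as a rewrite rule, this eliminates every product of \<open>s\<close> and
    \<open>k\<close>.\<close>
  have k: "s * k = 1/2 - k" using \<open>s \<ge> 0\<close> by (simp add: k_def field_simps)
  have k': "k * (s * x) = x / 2 - k * x" for x
    using arg_cong[OF k, of "\<lambda>y. y * x"] by (simp add: algebra_simps)
  have p: "p = k *\<^sub>R (c + d + 2 *\<^sub>R w)" by (simp add: p_def k_def)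
  then show [simp]: "p \<in> V" by simp
  have comm: "d \<odot> c = s *\<^sub>R w" "w \<odot> c = (1/2) *\<^sub>R (w + s *\<^sub>R c)" "w \<odot> d = (1/2) *\<^sub>R (w + s *\<^sub>R d)"
    using mul_commute[of d c] mul_commute[of w c] mul_commute[of w d] cd cw dw by auto
  note sq = \<open>c \<odot> c = c\<close> \<open>d \<odot> d = d\<close> cd cw dw ww comm
  have pc: "p \<odot> c = (1/2) *\<^sub>R (c + w)"
    by (rule eq_by_inner) (simp add: p mul_linear sq inner_simps algebra_simps k' add_divide_distrib diff_divide_distrib)
  have pd: "p \<odot> d = (1/2) *\<^sub>R (d + w)"
    by (rule eq_by_inner) (simp add: p mul_linear sq inner_simps algebra_simps k' add_divide_distrib diff_divide_distrib)
  have pw: "p \<odot> w = (1/4) *\<^sub>R (c + d) + (1/2) *\<^sub>R w"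
    by (rule eq_by_inner) (simp add: p mul_linear sq inner_simps algebra_simps k' add_divide_distrib diff_divide_distrib)
  have "p \<odot> (c + d + 2 *\<^sub>R w) = c + d + 2 *\<^sub>R w"
    by (rule eq_by_inner) (simp add: mul_linear pc pd pw inner_simps algebra_simps)
  then show "p \<odot> p = p" by (subst (2) p) (simp add: mul_linear p)
  show "peirce_reflection p c = d"
    unfolding peirce_reflection_def
    by (rule eq_by_inner) (simp add: mul_linear pc pw inner_simps algebra_simps)
qed

text \<open>Primitivity makes the span of \<open>c\<close>, \<open>d\<close> and
  \<open>c \<odot> d\<close> closed under multiplication, with structure constants given by a single
  number \<alpha>. In the model above \<alpha> is the squared cosine of the angle, so
  \<open>peirce_reflection_swap\<close> applies with s = sqrt \<alpha>.\<close>

lemma exchange_nonorthogonal: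
  assumes "primitive_idempotent V mul c" "primitive_idempotent V mul d" "c \<bullet> d \<noteq> 0"
  obtains p where "p \<in> V" "p \<odot> p = p" "peirce_reflection p c = d"
    "\<And>h. \<lbrakk>h \<in> V; h \<odot> h = h; h \<odot> c = 0; h \<odot> d = 0\<rbrakk> \<Longrightarrow> h \<odot> p = 0"
proof -
  note c = primitive_idempotentD[OF assms(1)] and d = primitive_idempotentD[OF assms(2)]
  define m where "m = c \<odot> d"
  note [simp] = c(1,2) d(1,2)
  have [simp]: "m \<in> V" by (simp add: m_def)
  have dc: "d \<odot> c = m" "c \<odot> d = m" unfolding m_def by (rule mul_commute[OF d(1) c(1)], rule refl)
  \<comment> \<open>The polynomial 2 t^2 - t takes the values 0, 0, 1 at t = 0, 1/2, 1, so this is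
    the Peirce 1-component of \<open>y\<close>.\<close>
  have in1: "2 *\<^sub>R (x \<odot> (x \<odot> y)) - x \<odot> y \<in> peirce 1 x" if "x \<in> V" "x \<odot> x = x" "y \<in> V" for x y
  proof -
    have "x \<odot> (2 *\<^sub>R (x \<odot> (x \<odot> y)) - x \<odot> y) = 2 *\<^sub>R (x \<odot> (x \<odot> y)) - x \<odot> y"
      by (rule eq_by_inner) (use that in \<open>simp add: mul_linear idempotent_cubic inner_simps\<close>)
    then show ?thesis using that by (simp add: peirce_def)
  qed
  obtain \<alpha> where \<alpha>: "2 *\<^sub>R (c \<odot> m) - m = \<alpha> *\<^sub>R c"
    using primitive_peirce_1[OF assms(1) in1[of c d]] by (auto simp: dc)
  obtain \<beta> where \<beta>: "2 *\<^sub>R (d \<odot> m) - m = \<beta> *\<^sub>R d"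
    using primitive_peirce_1[OF assms(2) in1[of d c]] by (auto simp: dc)
  have cm: "c \<odot> m = (1/2) *\<^sub>R (m + \<alpha> *\<^sub>R c)"
    using arg_cong[OF \<alpha>, of "\<lambda>v. (1/2) *\<^sub>R (m + v)"] by simp
  have dm: "d \<odot> m = (1/2) *\<^sub>R (m + \<beta> *\<^sub>R d)"
    using arg_cong[OF \<beta>, of "\<lambda>v. (1/2) *\<^sub>R (m + v)"] by simp
  have comm: "m \<odot> c = c \<odot> m" "m \<odot> d = d \<odot> m" by (rule mul_commute; simp)+
  \<comment> \<open>The square of \<open>m\<close> is computed from the linearised identity at
    \<open>c\<close> and then again at \<open>d\<close>; comparing the results gives \<beta> =
    \<alpha>.\<close>
  have mm: "4 *\<^sub>R (m \<odot> m) = \<alpha> *\<^sub>R c + \<beta> *\<^sub>R d + (2 * \<beta>) *\<^sub>R m"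
  proof (rule eq_by_inner)
    fix t show "(4 *\<^sub>R (m \<odot> m)) \<bullet> t = (\<alpha> *\<^sub>R c + \<beta> *\<^sub>R d + (2 * \<beta>) *\<^sub>R m) \<bullet> t"
      using arg_cong[OF idempotent_linearized[of c d d], of "\<lambda>v. v \<bullet> t"]
      by (simp add: dc comm cm dm mul_linear inner_simps algebra_simps)
  qed
  have mm': "4 *\<^sub>R (m \<odot> m) = \<alpha> *\<^sub>R c + \<beta> *\<^sub>R d + (2 * \<alpha>) *\<^sub>R m"
  proof (rule eq_by_inner)
    fix t show "(4 *\<^sub>R (m \<odot> m)) \<bullet> t = (\<alpha> *\<^sub>R c + \<beta> *\<^sub>R d + (2 * \<alpha>) *\<^sub>R m) \<bullet> t"
      using arg_cong[OF idempotent_linearized[of d c c], of "\<lambda>v. v \<bullet> t"]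
      by (simp add: dc comm cm dm mul_linear inner_simps algebra_simps)
  qed
  have cdm: "c \<bullet> d = c \<bullet> m" "d \<bullet> c = d \<bullet> m"
    using inner_associative[of c c d] inner_associative[of d d c] by (auto simp: dc)
  then have "m \<noteq> 0" using assms(3) by auto
  moreover have "(2 * \<beta>) *\<^sub>R m = (2 * \<alpha>) *\<^sub>R m" using mm mm' by auto
  ultimately have \<beta>: "\<beta> = \<alpha>" by simp
  have "c \<bullet> (c \<odot> m) = c \<bullet> m" "d \<bullet> (d \<odot> m) = d \<bullet> m"
    using inner_associative[of c c m] inner_associative[of d d m] by auto
  then have N: "c \<bullet> d = \<alpha> * (c \<bullet> c)" "d \<bullet> c = \<alpha> * (d \<bullet> d)"
    unfolding cm dm cdm \<beta> by (auto simp: inner_simps)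
  then have "\<alpha> \<noteq> 0" using assms(3) by auto
  then have ccdd: "c \<bullet> c = d \<bullet> d" using N by (simp add: inner_commute)
  \<comment> \<open>Positive definiteness at \<open>c + d\<close> gives 1 + \<alpha> \<ge> 0, and at
    the nonzero \<open>m\<close> it gives (1 + \<alpha>) \<alpha> > 0; together \<alpha> >
    0.\<close>
  have "0 \<le> (c + d) \<bullet> (c + d)" by simp
  then have "0 \<le> (1 + \<alpha>) * (2 * (c \<bullet> c))"
    using N ccdd by (simp add: inner_simps algebra_simps)
  then have "1 + \<alpha> \<ge> 0" using c(4) by (simp add: zero_le_mult_iff)
  have "m \<bullet> m = d \<bullet> (c \<odot> m)" using inner_associative[of c d m] by (simp add: dc)
  also have "\<dots> = (1 + \<alpha>) * \<alpha> * (c \<bullet> c) / 2"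
    using N cdm ccdd by (simp add: cm inner_simps algebra_simps)
  finally have "0 < (1 + \<alpha>) * \<alpha> * (c \<bullet> c) / 2" using \<open>m \<noteq> 0\<close> by (metis inner_gt_zero_iff)
  then have "\<alpha> > 0" using \<open>1 + \<alpha> \<ge> 0\<close> c(4) by (auto simp: zero_less_mult_iff)
  define s where "s = sqrt \<alpha>"
  have s: "s > 0" "s * s = \<alpha>" using \<open>\<alpha> > 0\<close> by (auto simp: s_def)
  define w where "w = (1 / s) *\<^sub>R m"
  define p where "p = (1 / (2 + 2 * s)) *\<^sub>R (c + d + 2 *\<^sub>R w)"
  have [simp]: "w \<in> V" by (simp add: w_def)
  have sw: "c \<odot> d = s *\<^sub>R w" using s by (simp add: w_def m_def)
  have s\<alpha>: "\<alpha> / s = s" using s by (simp add: field_simps)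
  have cw: "c \<odot> w = (1/2) *\<^sub>R (w + s *\<^sub>R c)" "d \<odot> w = (1/2) *\<^sub>R (w + s *\<^sub>R d)"
    using cm dm \<beta> s\<alpha> by (auto simp: w_def mul_linear scaleR_add_right)
  have "w \<odot> w = (1 / (4 * \<alpha>)) *\<^sub>R (4 *\<^sub>R (m \<odot> m))"
    using s by (simp add: w_def mul_linear field_simps)
  also have "\<dots> = (1/4) *\<^sub>R (c + d + (2 * s) *\<^sub>R w)"
    unfolding mm \<beta> using \<open>\<alpha> > 0\<close> s by (simp add: w_def scaleR_add_right)
  finally have ww: "w \<odot> w = (1/4) *\<^sub>R (c + d + (2 * s) *\<^sub>R w)" .
  have swap: "p \<in> V" "p \<odot> p = p" "peirce_reflection p c = d"
    unfolding p_def using peirce_reflection_swap[of c d w s] s sw cw ww by auto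
  have "h \<odot> p = 0" if h: "h \<in> V" "h \<odot> h = h" "h \<odot> c = 0" "h \<odot> d = 0" for h
  proof -
    have "c \<in> peirce 0 h" "d \<in> peirce 0 h" using h by (auto simp: peirce_def)
    then have "c \<odot> d \<in> peirce 0 h" using peirce_mult[OF h(1,2)] by blast
    then have "h \<odot> m = 0" by (auto simp: m_def peirce_def)
    then show ?thesis using h by (simp add: p_def w_def mul_linear)
  qed
  then show ?thesis using that swap by blast
qed

text \<open>The multiplications by \<open>c\<close> and \<open>d\<close> commute. Since
  \<open>c\<close> kills the 0-component of \<open>z\<close> and \<open>d\<close> kills its
  1-component, only half of \<open>d \<odot> u\<close> survives, with \<open>u\<close> the
  1/2-component; by symmetry the same holds for \<open>d\<close>.\<close>

lemma peirce_product:
  assumes c: "c \<in> V" "c \<odot> c = c" and d: "d \<in> V" "d \<odot> d = d" and cd: "c \<odot> d = 0" and z: "z \<in> V"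
  shows "c \<odot> (d \<odot> z) \<in> peirce (1/2) c" "c \<odot> (d \<odot> z) \<in> peirce (1/2) d"
proof -
  have half: "c \<odot> (d \<odot> z) \<in> peirce (1/2) c"
    if c: "c \<in> V" "c \<odot> c = c" and d: "d \<in> V" "d \<odot> d = d" and cd: "c \<odot> d = 0" for c d
  proof -
    obtain v u where "v \<in> even_part c" and u: "u \<in> peirce (1/2) c" and z': "z = v + u"
      using even_odd_decomposition[OF c z] by blast
    then obtain x y where x: "x \<in> peirce 1 c" and y: "y \<in> peirce 0 c" and v: "v = x + y"
      using even_part_decomposition[OF c] by blast
    note [simp] = peirceD[OF x] peirceD[OF y] peirceD[OF u] c d
    have "d \<in> peirce 0 c" using d cd by (simp add: peirce_def)
    then have "x \<odot> d = 0" "d \<odot> u \<in> peirce (1/2) c"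
      using peirce_10[OF c x] peirce_mult[OF c _ _ u] by auto
    moreover have "d \<odot> x = x \<odot> d" by (rule mul_commute) auto
    moreover have "c \<odot> (d \<odot> z) = d \<odot> (c \<odot> z)" using commute_peirce_0[OF c d(1) cd z] .
    ultimately have "c \<odot> (d \<odot> z) = (1/2) *\<^sub>R (d \<odot> u)" by (simp add: z' v mul_linear)
    then show ?thesis
      using subspace_scale[OF subspace_peirce[OF c(1)] \<open>d \<odot> u \<in> peirce (1/2) c\<close>] by simp
  qed
  show "c \<odot> (d \<odot> z) \<in> peirce (1/2) c" by (rule half[OF c d cd])
  have "d \<odot> c = 0" using mul_commute[of d c] c d cd by simp
  then show "c \<odot> (d \<odot> z) \<in> peirce (1/2) d"
    using half[OF d c] commute_peirce_0[OF c d(1) cd z] by simp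
qed

text \<open>The vector \<open>c \<odot> (d \<odot> z)\<close> lies in both 1/2-spaces. Its square is
  a multiple of \<open>c + q\<close>, and primitivity of \<open>d\<close> forces
  \<open>q = d\<close>; after rescaling this is the case s = 0 of
  \<open>peirce_reflection_swap\<close>.\<close>

lemma exchange_orthogonal:
  assumes "primitive_idempotent V mul c" "primitive_idempotent V mul d" and cd: "c \<odot> d = 0"
    and z: "z \<in> V" "c \<odot> (d \<odot> z) \<noteq> 0"
  obtains p where "p \<in> V" "p \<odot> p = p" "peirce_reflection p c = d" "peirce_reflection p d = c"
    "\<And>h. \<lbrakk>h \<in> V; h \<odot> h = h; h \<odot> c = 0; h \<odot> d = 0\<rbrakk> \<Longrightarrow> h \<odot> p = 0"
proof -
  note c = primitive_idempotentD[OF assms(1)] and d = primitive_idempotentD[OF assms(2)]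
  note [simp] = c(1,2) d(1,2)
  define u where "u = c \<odot> (d \<odot> z)"
  have u: "u \<in> peirce (1/2) c" "u \<in> peirce (1/2) d"
    using peirce_product[OF c(1,2) d(1,2) cd z(1)] by (auto simp: u_def)
  note [simp] = peirceD[OF u(1)] peirceD[OF u(2)]
  have "u \<noteq> 0" using z by (simp add: u_def)
  then obtain q \<alpha> where q: "\<alpha> > 0" "q \<in> V" "q \<odot> q = q" "c \<odot> q = 0" "q \<odot> u = (1/2) *\<^sub>R u"
      "u \<odot> u = \<alpha> *\<^sub>R (c + q)" "q \<bullet> q = c \<bullet> c"
    using peirce_half_square_primitive[OF assms(1) u(1)] by metis
  have dc: "d \<odot> c = 0" using mul_commute[of d c] cd by simp
  have cd1: "c + d \<in> V" "(c + d) \<odot> (c + d) = c + d" using cd dc by (auto simp: mul_linear)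
  \<comment> \<open>The two eigenvalues 1/2 add up to 1, so \<open>u\<close>, its square and hence
    \<open>c + q\<close> lie in the corner of \<open>c + d\<close>.\<close>
  have "u \<in> peirce 1 (c + d)" by (simp add: peirce_def mul_linear flip: scaleR_left_distrib)
  then have "u \<odot> u \<in> peirce 1 (c + d)" using peirce_mult[OF cd1] by blast
  then have "\<alpha> *\<^sub>R ((c + d) \<odot> (c + q)) = \<alpha> *\<^sub>R (c + q)" using q by (auto simp: peirce_def mul_linear)
  then have "(c + d) \<odot> (c + q) = c + q" using q(1) by simp
  then have "d \<odot> q = q" using q by (simp add: mul_linear dc)
  then obtain r where r: "q = r *\<^sub>R d"
    using primitive_peirce_1[OF assms(2), of q] q by (auto simp: peirce_def)
  have "q \<noteq> 0" using q(7) c(3) by auto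
  then have "r \<noteq> 0" "r * r = r" using q(3) r d(3) by (auto simp: mul_linear)
  then have "q = d" using r by simp
  define w where "w = (1 / (2 * sqrt \<alpha>)) *\<^sub>R u"
  \<comment> \<open>The summand \<open>2 * 0\<close> keeps the shape of \<open>p\<close> in
    \<open>peirce_reflection_swap\<close> at s = 0.\<close>
  define p where "p = (1 / (2 + 2 * 0)) *\<^sub>R (c + d + 2 *\<^sub>R w)"
  have [simp]: "w \<in> V" by (simp add: w_def)
  have w: "c \<odot> w = (1/2) *\<^sub>R w" "d \<odot> w = (1/2) *\<^sub>R w" by (auto simp: w_def mul_linear)
  have ww: "w \<odot> w = (1/4) *\<^sub>R (c + d)" using q \<open>q = d\<close> by (simp add: w_def mul_linear)
  have p: "p \<in> V" "p \<odot> p = p" "peirce_reflection p c = d"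
    unfolding p_def using peirce_reflection_swap[of c d w 0] cd w ww by auto
  moreover have "peirce_reflection p d = c"
    unfolding p_def using peirce_reflection_swap(3)[of d c w 0] dc w ww by (auto simp: add.commute)
  moreover have "h \<odot> p = 0" if h: "h \<in> V" "h \<odot> h = h" "h \<odot> c = 0" "h \<odot> d = 0" for h
  proof -
    have "(c + d) \<odot> h = 0" using h mul_commute[of "c + d" h] by (simp add: mul_linear)
    then have "h \<in> peirce 0 (c + d)" using h by (simp add: peirce_def)
    then have "u \<odot> h = 0" using peirce_10[OF cd1 \<open>u \<in> peirce 1 (c + d)\<close>] by blast
    then have "h \<odot> u = 0" using mul_commute[of h u] h by simp
    then show ?thesis using h by (simp add: p_def w_def mul_linear)
  qed
  ultimately show ?thesis using that by blast
qed

lemma peirce_reflection_fixes: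
  "\<lbrakk>p \<in> V; h \<in> V; h \<odot> p = 0\<rbrakk> \<Longrightarrow> peirce_reflection p h = h"
  using mul_commute[of p h] by (simp add: peirce_reflection_def mul_linear)

text \<open>A further element of \<open>G\<close> would be orthogonal to all of \<open>F\<close>,
  hence annihilated by the unit, which is the sum of \<open>F\<close>.\<close>

lemma frame_subset_eq:
  assumes F: "jordan_frame V mul e F" and G: "jordan_frame V mul e G" and "F \<subseteq> G"
  shows "F = G"
proof (rule ccontr)
  note F = jordan_frameD[OF F] and G = jordan_frameD[OF G]
  assume "F \<noteq> G"
  then obtain c where c: "c \<in> G" "c \<notin> F" using \<open>F \<subseteq> G\<close> by blast
  have "c = c \<odot> \<Sum>F" using G(3)[OF c(1)] F(8) by (simp add: mul_linear)
  also have "\<dots> = (\<Sum>d\<in>F. c \<odot> d)" using mul_sum_right[of F "\<lambda>x. x" c] F(3) G(3)[OF c(1)] by simp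
  also have "\<dots> = 0" using G(7) c \<open>F \<subseteq> G\<close> by (intro sum.neutral) auto
  finally show False using G(5) c by blast
qed

text \<open>Each reflection moves an element of \<open>F\<close> outside \<open>G\<close> to an
  element of \<open>G\<close> and fixes the common elements, so the number of elements outside
  \<open>G\<close> drops.\<close>

lemma jordan_frames_conjugate:
  assumes "jordan_frame V mul e F" "jordan_frame V mul e G"
  shows "\<exists>A\<in>jordan_Aut V mul. A ` F = G"
  using assms(1)
proof (induction "card (F - G)" arbitrary: F rule: less_induct)
  case less
  note F = jordan_frameD[OF less.prems] and G = jordan_frameD[OF assms(2)]
  show ?case
  proof (cases "F \<subseteq> G")
    case True
    then have "F = G" using frame_subset_eq less.prems assms(2) by blast
    then show ?thesis using jordan_Aut_id by force
  next
    case False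
    then obtain c where c: "c \<in> F" "c \<notin> G" by blast
    \<comment> \<open>As \<open>G\<close> sums to the unit, these inner products add up to <c, e> =
      <c, c> > 0, so some \<open>d\<close> in \<open>G\<close> is not orthogonal to
      \<open>c\<close>.\<close>
    have "(\<Sum>d\<in>G. c \<bullet> d) = c \<bullet> c"
      using idempotent_inner_unit[of c] F(3,4) c(1) by (simp add: inner_sum_right[symmetric] G(8))
    then have "(\<Sum>d\<in>G. c \<bullet> d) \<noteq> 0" using F(6) c(1) by fastforce
    then obtain d where d: "d \<in> G" "c \<bullet> d \<noteq> 0" by (meson sum.neutral)
    have "d \<notin> F"
      using F(3,4,7) c d idempotent_orthogonal_inner by metis
    obtain p where p: "p \<in> V" "p \<odot> p = p" "peirce_reflection p c = d"
      "\<And>h. \<lbrakk>h \<in> V; h \<odot> h = h; h \<odot> c = 0; h \<odot> d = 0\<rbrakk> \<Longrightarrow> h \<odot> p = 0"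
      using exchange_nonorthogonal F(2)[OF c(1)] G(2)[OF d(1)] d(2) by metis
    let ?S = "peirce_reflection p"
    have S: "?S \<in> jordan_Aut V mul" using peirce_reflection_Aut p by blast
    have fixed: "?S h = h" if "h \<in> F \<inter> G" for h
    proof -
      have "h \<noteq> c" "h \<noteq> d" using that c \<open>d \<notin> F\<close> by auto
      then have "h \<odot> p = 0" using that F(3,4,7) G(7) c d(1) by (intro p(4)) auto
      then show ?thesis using peirce_reflection_fixes p(1) that F(3) by blast
    qed
    have SF: "jordan_frame V mul e (?S ` F)" using jordan_Aut_frame S less.prems by blast
    have "inj_on ?S F" using jordan_AutD(6)[OF S] F(3) by (meson inj_on_subset subsetI)
    then have card: "card (?S ` F) = card F" by (rule card_image)
    have "insert d (F \<inter> G) \<subseteq> ?S ` F \<inter> G" using p(3) c(1) d(1) fixed by force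
    moreover have "finite (?S ` F \<inter> G)" using G(1) by blast
    ultimately have "card (insert d (F \<inter> G)) \<le> card (?S ` F \<inter> G)" by (rule card_mono[rotated])
    then have "card (F \<inter> G) < card (?S ` F \<inter> G)" using \<open>d \<notin> F\<close> F(1) by simp
    moreover have "card (F - G) + card (F \<inter> G) = card F" "card (?S ` F - G) + card (?S ` F \<inter> G) = card F"
      using card_Int_Diff[of F G] card_Int_Diff[of "?S ` F" G] F(1) card by auto
    ultimately have "card (?S ` F - G) < card (F - G)" by linarith
    from less.hyps[OF this SF] obtain A where A: "A \<in> jordan_Aut V mul" "A ` (?S ` F) = G" by blast
    then have "(A \<circ> ?S) ` F = G" by (simp add: image_comp)
    then show ?thesis using jordan_Aut_comp[OF A(1) S] by blast
  qed
qed

end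

section \<open>Eigenvalues\<close>

lemma sum_indicator_scaleR:
  fixes h :: "'i \<Rightarrow> 'a::real_vector"
  assumes "finite K"
  shows "(\<Sum>i\<in>K. (if P i then 1 else 0) *\<^sub>R h i) = (\<Sum>i | i \<in> K \<and> P i. h i)"
proof -
  have "(\<Sum>i\<in>K. (if P i then 1 else 0) *\<^sub>R h i) = (\<Sum>i\<in>K. if P i then h i else 0)"
    by (rule sum.cong) auto
  then show ?thesis using assms by (simp add: sum.inter_filter)
qed

context euclidean_jordan_algebra
begin

lemma jordan_frames_card_eq:
  assumes "jordan_frame V mul e F" "jordan_frame V mul e G"
  shows "card F = card G"
proof -
  obtain A where A: "A \<in> jordan_Aut V mul" "A ` F = G" using jordan_frames_conjugate assms by blast
  moreover have "inj_on A F" using jordan_AutD(6)[OF A(1)] jordan_frameD(3)[OF assms(1)]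
    by (meson inj_on_subset subsetI)
  ultimately show ?thesis using card_image[of A F] by simp
qed

lemma jordan_rank_eq:
  assumes "jordan_frame V mul e F"
  shows "jordan_rank V mul e = card F"
  unfolding jordan_rank_def
proof (rule the_equality)
  show "\<exists>G. jordan_frame V mul e G \<and> card G = card F" using assms by blast
  show "n = card F" if "\<exists>G. jordan_frame V mul e G \<and> card G = n" for n
    using that jordan_frames_card_eq[OF assms] by force
qed

lemma jordan_frame_exists: "\<exists>F. jordan_frame V mul e F"
  using spectral_decomposition_exists[OF euclidean_jordan_algebra_axioms unit_closed] by blast

section \<open>Indexed frames and multiplicities of eigenvalues\<close>

text \<open>The index type is free: initial segments of the naturals serve the eigenvalue map, and a
  frame indexed by itself serves permutations of its elements.\<close>

definition frame_family :: "'i set \<Rightarrow> ('i \<Rightarrow> 'a) \<Rightarrow> bool" where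
  "frame_family I f \<longleftrightarrow> inj_on f I \<and> jordan_frame V mul e (f ` I)"

lemma frame_familyD:
  assumes "frame_family I f"
  shows "inj_on f I" "jordan_frame V mul e (f ` I)" "finite I" "\<And>i. i \<in> I \<Longrightarrow> f i \<in> V"
    "\<And>i. i \<in> I \<Longrightarrow> f i \<odot> f i = f i" "\<And>i j. i \<in> I \<Longrightarrow> j \<in> I \<Longrightarrow> i \<noteq> j \<Longrightarrow> f i \<odot> f j = 0"
    "\<And>i. i \<in> I \<Longrightarrow> f i \<noteq> 0" "(\<Sum>i\<in>I. f i) = e"
proof -
  show inj: "inj_on f I" and F: "jordan_frame V mul e (f ` I)" using assms by (auto simp: frame_family_def)
  note F = jordan_frameD[OF F]
  show "finite I" using F(1) inj by (rule finite_imageD)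
  show "(\<Sum>i\<in>I. f i) = e" using F(8) inj by (simp add: sum.reindex)
  show "f i \<in> V" "f i \<odot> f i = f i" "f i \<noteq> 0" if "i \<in> I" for i using F(3-5) that by auto
  show "f i \<odot> f j = 0" if "i \<in> I" "j \<in> I" "i \<noteq> j" for i j
    using F(7)[of "f i" "f j"] that inj by (auto dest: inj_onD)
qed

lemma frame_family_Aut:
  assumes f: "frame_family I f" and A: "A \<in> jordan_Aut V mul"
  shows "frame_family I (A \<circ> f)"
proof -
  have "inj_on A (f ` I)" using jordan_AutD(6)[OF A] frame_familyD(4)[OF f]
    by (meson image_subsetI inj_on_subset)
  then show ?thesis
    using frame_familyD(1,2)[OF f] jordan_Aut_frame[OF A]
    unfolding frame_family_def image_comp[symmetric] by (blast intro: comp_inj_on)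
qed

lemma frame_family_mul:
  assumes f: "frame_family I f"
  shows "(\<Sum>i\<in>I. a i *\<^sub>R f i) \<odot> (\<Sum>i\<in>I. b i *\<^sub>R f i) = (\<Sum>i\<in>I. (a i * b i) *\<^sub>R f i)"
proof -
  note f = frame_familyD[OF f]
  have "(\<Sum>i\<in>I. a i *\<^sub>R f i) \<odot> (\<Sum>j\<in>I. b j *\<^sub>R f j) = (\<Sum>i\<in>I. (a i *\<^sub>R f i) \<odot> (\<Sum>j\<in>I. b j *\<^sub>R f j))"
    by (rule mul_sum_left) (auto simp: f(4))
  also have "\<dots> = (\<Sum>i\<in>I. (a i * b i) *\<^sub>R f i)"
  proof (rule sum.cong)
    fix i assume i: "i \<in> I"
    have "(a i *\<^sub>R f i) \<odot> (\<Sum>j\<in>I. b j *\<^sub>R f j) = (\<Sum>j\<in>I. (a i *\<^sub>R f i) \<odot> (b j *\<^sub>R f j))"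
      by (rule mul_sum_right) (auto simp: f(4) i)
    also have "\<dots> = (\<Sum>j\<in>I. if j = i then (a i * b i) *\<^sub>R f i else 0)"
      by (rule sum.cong) (auto simp: f(4,5,6) i mul_linear)
    finally show "(a i *\<^sub>R f i) \<odot> (\<Sum>j\<in>I. b j *\<^sub>R f j) = (a i * b i) *\<^sub>R f i"
      using f(3) i by simp
  qed simp
  finally show ?thesis .
qed

text \<open>
  Both sides agree after applying any polynomial to the coefficients, in particular the Lagrange
  polynomial that is 1 at \<open>\<mu>\<close> and vanishes at the other eigenvalues.
\<close>

lemma spectral_idempotents_eq:
  assumes f: "frame_family I f" and g: "frame_family J g"
    and eq: "(\<Sum>i\<in>I. l i *\<^sub>R f i) = (\<Sum>j\<in>J. m j *\<^sub>R g j)"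
  shows "(\<Sum>i | i \<in> I \<and> l i = \<mu>. f i) = (\<Sum>j | j \<in> J \<and> m j = \<mu>. g j)"
proof -
  define N where "N = (l ` I \<union> m ` J) - {\<mu>}"
  define good where "good P \<longleftrightarrow> (\<Sum>i\<in>I. P (l i) *\<^sub>R f i) = (\<Sum>j\<in>J. P (m j) *\<^sub>R g j)"
    for P :: "real \<Rightarrow> real"
  have good_mult: "good (\<lambda>t. P t * Q t)" if "good P" "good Q" for P Q
    using that frame_family_mul[OF f, of "\<lambda>i. P (l i)" "\<lambda>i. Q (l i)"]
      frame_family_mul[OF g, of "\<lambda>i. P (m i)" "\<lambda>i. Q (m i)"]
    by (simp add: good_def)
  have good_linear: "good (\<lambda>t. a * t + b)" for a b
  proof -
    have "(\<Sum>i\<in>I. (a * l i + b) *\<^sub>R f i) = a *\<^sub>R (\<Sum>i\<in>I. l i *\<^sub>R f i) + b *\<^sub>R (\<Sum>i\<in>I. f i)"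
      by (simp add: scaleR_add_left sum.distrib scaleR_sum_right)
    also have "\<dots> = a *\<^sub>R (\<Sum>j\<in>J. m j *\<^sub>R g j) + b *\<^sub>R (\<Sum>j\<in>J. g j)"
      using eq frame_familyD(8)[OF f] frame_familyD(8)[OF g] by simp
    also have "\<dots> = (\<Sum>j\<in>J. (a * m j + b) *\<^sub>R g j)"
      by (simp add: scaleR_add_left sum.distrib scaleR_sum_right)
    finally show ?thesis by (simp add: good_def)
  qed
  have "finite N" using frame_familyD(3)[OF f] frame_familyD(3)[OF g] by (simp add: N_def)
  then have "good (\<lambda>t. \<Prod>\<nu>\<in>N. (1 / (\<mu> - \<nu>)) * t + (- \<nu> / (\<mu> - \<nu>)))"
  proof (induction N rule: finite_induct)
    case empty
    then show ?case using good_linear[of 0 1] by simp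
  next
    case (insert \<nu> N)
    then show ?case using good_mult[OF good_linear[of "1 / (\<mu> - \<nu>)" "- \<nu> / (\<mu> - \<nu>)"] insert.IH] by simp
  qed
  moreover have "(\<Prod>\<nu>\<in>N. (1 / (\<mu> - \<nu>)) * t + (- \<nu> / (\<mu> - \<nu>))) = (if t = \<mu> then 1 else 0)"
    if "t \<in> l ` I \<union> m ` J" for t
  proof (cases "t = \<mu>")
    case True
    have "(\<Prod>\<nu>\<in>N. (1 / (\<mu> - \<nu>)) * t + (- \<nu> / (\<mu> - \<nu>))) = (\<Prod>\<nu>\<in>N. 1)"
      by (rule prod.cong) (auto simp: True N_def diff_divide_distrib[symmetric])
    then show ?thesis using True by simp
  next
    case False
    then have "t \<in> N" using that by (simp add: N_def)
    then have "(\<Prod>\<nu>\<in>N. (1 / (\<mu> - \<nu>)) * t + (- \<nu> / (\<mu> - \<nu>))) = 0"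
      using \<open>finite N\<close> by (intro prod_zero) (auto intro!: bexI[of _ t])
    then show ?thesis using False by simp
  qed
  ultimately have "(\<Sum>i\<in>I. (if l i = \<mu> then 1 else 0) *\<^sub>R f i) = (\<Sum>j\<in>J. (if m j = \<mu> then 1 else 0) *\<^sub>R g j)"
    by (simp add: good_def)
  then show ?thesis
    unfolding sum_indicator_scaleR[OF frame_familyD(3)[OF f]] sum_indicator_scaleR[OF frame_familyD(3)[OF g]] .
qed

text \<open>Exchanging the part of one frame that spans the spectral idempotent yields another frame.\<close>

lemma eigenvalue_multiplicity_eq:
  assumes f: "frame_family I f" and g: "frame_family J g"
    and eq: "(\<Sum>i\<in>I. l i *\<^sub>R f i) = (\<Sum>j\<in>J. m j *\<^sub>R g j)"
  shows "card {i \<in> I. l i = \<mu>} = card {j \<in> J. m j = \<mu>}"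
proof -
  define a where "a = (\<Sum>i | i \<in> I \<and> l i = \<mu>. f i)"
  have a': "a = (\<Sum>j | j \<in> J \<and> m j = \<mu>. g j)"
    unfolding a_def by (rule spectral_idempotents_eq[OF assms])
  have ff: "jordan_frame V mul e (f ` I)" and gg: "jordan_frame V mul e (g ` J)"
    using f g by (auto simp: frame_family_def)
  note f = frame_familyD[OF f] and g = frame_familyD[OF g]
  have aV: "a \<in> V" unfolding a_def by (auto intro!: subspace_sum[OF subspace] f(4))
  have a_g: "g k \<in> peirce 1 a" if "k \<in> J" "m k = \<mu>" for k
  proof -
    have "a \<odot> g k = (\<Sum>j | j \<in> J \<and> m j = \<mu>. g j \<odot> g k)"
      unfolding a' by (rule mul_sum_left) (auto simp: g(4) that)
    also have "\<dots> = (\<Sum>j | j \<in> J \<and> m j = \<mu>. if j = k then g k else 0)"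
      by (rule sum.cong) (auto simp: g(5,6) that)
    also have "\<dots> = g k" using that g(3) by simp
    finally show ?thesis using g(4) that by (simp add: peirce_def)
  qed
  have "a \<odot> (\<Sum>j | j \<in> J \<and> m j = \<mu>. g j) = (\<Sum>j | j \<in> J \<and> m j = \<mu>. a \<odot> g j)"
    by (rule mul_sum_right) (auto simp: g(4) aV)
  also have "\<dots> = (\<Sum>j | j \<in> J \<and> m j = \<mu>. g j)"
    using a_g by (intro sum.cong) (auto simp: peirce_def)
  finally have "a \<odot> a = a" by (simp flip: a')
  have a_f: "f k \<in> peirce 0 a" if "k \<in> I" "l k \<noteq> \<mu>" for k
  proof -
    have "a \<odot> f k = (\<Sum>i | i \<in> I \<and> l i = \<mu>. f i \<odot> f k)"
      unfolding a_def by (rule mul_sum_left) (auto simp: f(4) that)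
    also have "\<dots> = 0"
      using that by (intro sum.neutral) (auto intro!: f(6))
    finally show ?thesis using f(4) that by (simp add: peirce_def)
  qed
  have gf: "g j \<odot> f i = 0" "f i \<odot> g j = 0" if "j \<in> J" "m j = \<mu>" "i \<in> I" "l i \<noteq> \<mu>" for i j
    using peirce_10[OF aV \<open>a \<odot> a = a\<close> a_g a_f] that mul_commute[of "f i" "g j"] f(4) g(4) by auto
  define G1 where "G1 = g ` {j \<in> J. m j = \<mu>}"
  define F2 where "F2 = f ` {i \<in> I. l i \<noteq> \<mu>}"
  have fin: "finite G1" "finite F2" using f(3) g(3) by (auto simp: G1_def F2_def)
  have disj: "G1 \<inter> F2 = {}"
  proof (rule ccontr)
    assume "G1 \<inter> F2 \<noteq> {}"
    then obtain i j where ij: "j \<in> J" "m j = \<mu>" "i \<in> I" "l i \<noteq> \<mu>" "g j = f i"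
      by (auto simp: G1_def F2_def)
    then show False using gf(1)[OF ij(1-4)] f(5,7) by simp
  qed
  have sG: "\<Sum>G1 = a"
    unfolding G1_def a' by (subst sum.reindex) (auto intro: inj_on_subset[OF g(1)])
  have sF: "\<Sum>F2 = (\<Sum>i | i \<in> I \<and> l i \<noteq> \<mu>. f i)"
    unfolding F2_def by (subst sum.reindex) (auto intro: inj_on_subset[OF f(1)])
  have "e = a + (\<Sum>i | i \<in> I \<and> l i \<noteq> \<mu>. f i)"
    unfolding a_def f(8)[symmetric] using f(3)
    by (subst sum.union_disjoint[symmetric]) (auto intro: sum.cong)
  then have "\<Sum>(G1 \<union> F2) = e" using fin disj sG sF by (simp add: sum.union_disjoint)
  then have "jordan_frame V mul e (G1 \<union> F2)"
    using fin gf jordan_frameD(2,7)[OF ff] jordan_frameD(2,7)[OF gg]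
    unfolding jordan_frame_def by (auto simp: G1_def F2_def)
  then have "card (G1 \<union> F2) = card (f ` I)" using jordan_frames_card_eq ff by blast
  then have "card G1 + card F2 = card I" using fin disj f(1) by (simp add: card_Un_disjoint card_image)
  moreover have "card G1 = card {j \<in> J. m j = \<mu>}" "card F2 = card {i \<in> I. l i \<noteq> \<mu>}"
    unfolding G1_def F2_def by (auto intro!: card_image intro: inj_on_subset[OF f(1)] inj_on_subset[OF g(1)])
  moreover have "card {i \<in> I. l i = \<mu>} + card {i \<in> I. l i \<noteq> \<mu>} = card I"
    using f(3) by (subst card_Un_disjoint[symmetric]) (auto intro: arg_cong[where f = card])
  ultimately show ?thesis by linarith
qed

section \<open>Well-definedness of the eigenvalue map\<close>

text \<open>The condition under the definite description in \<open>eigenvalue_map\<close>, with the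
  frame as an explicit argument.\<close>

definition ordered_decomposition :: "'a \<Rightarrow> (nat \<Rightarrow> real) \<Rightarrow> (nat \<Rightarrow> 'a) \<Rightarrow> bool" where
  "ordered_decomposition x l f \<longleftrightarrow>
     l \<in> Rn (jordan_rank V mul e) \<and> (\<forall>i j. i \<le> j \<and> j < jordan_rank V mul e \<longrightarrow> l j \<le> l i) \<and>
     frame_family {..<jordan_rank V mul e} f \<and> x = (\<Sum>i<jordan_rank V mul e. l i *\<^sub>R f i)"

lemma ordered_decomposition_exists:
  assumes "x \<in> V"
  obtains l f where "ordered_decomposition x l f"
proof -
  obtain F k where F: "jordan_frame V mul e F" and x: "x = (\<Sum>c\<in>F. k c *\<^sub>R c)"
    using spectral_decomposition_exists[OF euclidean_jordan_algebra_axioms assms] by blast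
  obtain ys where ys: "set ys = F" "distinct ys"
    using finite_distinct_list jordan_frameD(1)[OF F] by blast
  \<comment> \<open>The negated key turns increasing sorting into decreasing eigenvalues.\<close>
  define xs where "xs = sort_key (\<lambda>c. - k c) ys"
  have xs: "set xs = F" "distinct xs" using ys by (auto simp: xs_def)
  then have n: "length xs = card F" by (metis distinct_card)
  have rank: "jordan_rank V mul e = card F" using jordan_rank_eq[OF F] .
  have sorted: "sorted (map (\<lambda>c. - k c) xs)" by (simp add: xs_def)
  \<comment> \<open>The value 0 from the rank on is what membership in \<open>Rn\<close>
    demands.\<close>
  define l where "l i = (if i < card F then k (xs ! i) else 0)" for i
  have bij: "bij_betw ((!) xs) {..<card F} F"
    using bij_betw_nth[OF xs(2)] n xs(1) by simp
  have "ordered_decomposition x l ((!) xs)"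
    unfolding ordered_decomposition_def rank
  proof (intro conjI allI impI)
    show "l \<in> Rn (card F)" by (simp add: Rn_def l_def)
    show "l j \<le> l i" if "i \<le> j \<and> j < card F" for i j
      using sorted_nth_mono[OF sorted, of i j] that n by (simp add: l_def)
    show "frame_family {..<card F} ((!) xs)"
      using bij F by (simp add: frame_family_def bij_betw_def)
    show "x = (\<Sum>i<card F. l i *\<^sub>R xs ! i)"
      unfolding x using sum.reindex_bij_betw[OF bij, of "\<lambda>c. k c *\<^sub>R c"] by (simp add: l_def)
  qed
  then show ?thesis using that by blast
qed

text \<open>Equal multiplicities mean equal multisets of eigenvalues, and a multiset has only one
  sorted list. The lists are reversed because \<open>sorted\<close> means increasing.\<close>

lemma ordered_decomposition_unique:
  assumes "ordered_decomposition x l f" "ordered_decomposition x m g"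
  shows "l = m"
proof -
  let ?n = "jordan_rank V mul e"
  have l: "l \<in> Rn ?n" "\<forall>i j. i \<le> j \<longrightarrow> j < ?n \<longrightarrow> l j \<le> l i" and m: "m \<in> Rn ?n" "\<forall>i j. i \<le> j \<longrightarrow> j < ?n \<longrightarrow> m j \<le> m i"
    using assms by (auto simp: ordered_decomposition_def)
  have "card {i \<in> {..<?n}. l i = \<mu>} = card {i \<in> {..<?n}. m i = \<mu>}" for \<mu>
    using assms unfolding ordered_decomposition_def
    by (intro eigenvalue_multiplicity_eq[where f = f and g = g]) auto
  moreover have "count (mset (map k [0..<?n])) \<mu> = card {i \<in> {..<?n}. k i = \<mu>}" for k :: "nat \<Rightarrow> real" and \<mu>
  proof -
    have "count (mset (map k [0..<?n])) \<mu> = card {i. i < ?n \<and> \<mu> = map k [0..<?n] ! i}"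
      unfolding count_mset count_list_eq_length_filter length_filter_conv_card by simp
    also have "{i. i < ?n \<and> \<mu> = map k [0..<?n] ! i} = {i \<in> {..<?n}. k i = \<mu>}" by auto
    finally show ?thesis .
  qed
  ultimately have "mset (map l [0..<?n]) = mset (map m [0..<?n])" by (intro multiset_eqI) simp
  then have "mset (rev (map l [0..<?n])) = mset (rev (map m [0..<?n]))" by simp
  moreover have "sorted (rev (map l [0..<?n]))" "sorted (rev (map m [0..<?n]))"
    using l(2) m(2) by (auto simp: sorted_rev_iff_nth_mono)
  ultimately have "rev (map l [0..<?n]) = rev (map m [0..<?n])"
    by (metis properties_for_sort)
  then have "l i = m i" if "i < ?n" for i using that by simp
  moreover have "l i = m i" if "\<not> i < ?n" for i using that l(1) m(1) by (simp add: Rn_def)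
  ultimately show ?thesis by blast
qed

lemma eigenvalue_map_eq:
  assumes "ordered_decomposition x l f"
  shows "eigenvalue_map V mul e x = l"
proof -
  have *: "ordered_decomposition x m g \<longleftrightarrow> m \<in> Rn (jordan_rank V mul e) \<and>
      (\<forall>i j. i \<le> j \<and> j < jordan_rank V mul e \<longrightarrow> m j \<le> m i) \<and>
      (inj_on g {..<jordan_rank V mul e} \<and> jordan_frame V mul e (g ` {..<jordan_rank V mul e}) \<and>
        x = (\<Sum>i<jordan_rank V mul e. m i *\<^sub>R g i))" for m g
    by (auto simp: ordered_decomposition_def frame_family_def)
  show ?thesis
    unfolding eigenvalue_map_def Let_def
    by (rule the_equality) (use assms ordered_decomposition_unique * in blast)+
qed

section \<open>Spectral sets and homogeneity of frames\<close>

definition frame_homogeneous :: bool where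
  "frame_homogeneous \<longleftrightarrow> (\<forall>F \<sigma>. jordan_frame V mul e F \<longrightarrow> \<sigma> permutes F \<longrightarrow>
     (\<exists>A\<in>jordan_Aut V mul. \<forall>c\<in>F. A c = \<sigma> c))"

text \<open>Conjugacy carries one frame onto the other as a set; homogeneity then corrects the
  order.\<close>

lemma frame_homogeneous_families:
  assumes "frame_homogeneous" and f: "frame_family {..<n} f" and g: "frame_family {..<n::nat} g"
  shows "\<exists>A\<in>jordan_Aut V mul. \<forall>i<n. A (f i) = g i"
proof -
  note f' = frame_familyD[OF f] and g' = frame_familyD[OF g]
  obtain B where B: "B \<in> jordan_Aut V mul" "B ` f ` {..<n} = g ` {..<n}"
    using jordan_frames_conjugate[OF f'(2) g'(2)] by blast
  define h where "h = B \<circ> f"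
  have "frame_family {..<n} h" using frame_family_Aut[OF f B(1)] by (simp add: h_def)
  then have h: "bij_betw h {..<n} (g ` {..<n})"
    using B(2) by (auto simp: h_def frame_family_def bij_betw_def image_comp)
  \<comment> \<open>The permutation that sends \<open>B (f i)\<close> to \<open>g i\<close>.\<close>
  define \<sigma> where "\<sigma> c = (if c \<in> g ` {..<n} then g (inv_into {..<n} h c) else c)" for c
  have "bij_betw (g \<circ> inv_into {..<n} h) (g ` {..<n}) (g ` {..<n})"
    by (rule bij_betw_trans[OF bij_betw_inv_into[OF h] inj_on_imp_bij_betw[OF g'(1)]])
  then have "bij_betw \<sigma> (g ` {..<n}) (g ` {..<n})"
    by (rule iffD1[OF bij_betw_cong, rotated]) (simp add: \<sigma>_def)
  then have "\<sigma> permutes g ` {..<n}" by (rule bij_imp_permutes) (simp add: \<sigma>_def)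
  then obtain A where A: "A \<in> jordan_Aut V mul" "\<forall>c\<in>g ` {..<n}. A c = \<sigma> c"
    using assms(1) g'(2) unfolding frame_homogeneous_def by blast
  have "(A \<circ> B) (f i) = g i" if "i < n" for i
  proof -
    have "h i \<in> g ` {..<n}" using h that by (auto simp: bij_betw_def)
    moreover have "inv_into {..<n} h (h i) = i" using h that by (simp add: bij_betw_def)
    moreover have "A (h i) = \<sigma> (h i)" using A(2) \<open>h i \<in> g ` {..<n}\<close> by blast
    ultimately have "A (h i) = g i" unfolding \<sigma>_def by simp
    then show ?thesis by (simp add: h_def)
  qed
  then show ?thesis using jordan_Aut_comp[OF A(1) B(1)] by blast
qed

text \<open>If the eigenvalues of \<open>y\<close> rearrange those of some \<open>x\<close> in
  \<open>E\<close>, an automorphism matching the two indexed frames maps \<open>x\<close> to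
  \<open>y\<close>, so \<open>y\<close> belongs to \<open>E\<close>.\<close>

lemma frame_homogeneous_imp_spectral:
  assumes hom: "frame_homogeneous" and E: "weakly_spectral_set V mul E"
  shows "spectral_set V mul e E"
proof -
  let ?n = "jordan_rank V mul e"
  \<comment> \<open>All rearrangements are included so that the set is permutation invariant by
    construction.\<close>
  define Q where "Q = {eigenvalue_map V mul e x \<circ> \<sigma> | x \<sigma>. x \<in> E \<and> \<sigma> permutes {..<?n}}"
  have EV: "E \<subseteq> V" and EA: "\<And>A x. A \<in> jordan_Aut V mul \<Longrightarrow> x \<in> E \<Longrightarrow> A x \<in> E"
    using E by (auto simp: weakly_spectral_set_def)
  have "Q \<subseteq> Rn ?n"
  proof
    fix q assume "q \<in> Q"
    then obtain x \<sigma> where x: "x \<in> E" "\<sigma> permutes {..<?n}" "q = eigenvalue_map V mul e x \<circ> \<sigma>"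
      by (auto simp: Q_def)
    obtain l f where d: "ordered_decomposition x l f" using ordered_decomposition_exists x EV by blast
    then have "l \<in> Rn ?n" by (simp add: ordered_decomposition_def)
    then show "q \<in> Rn ?n"
      using permutes_not_in[OF x(2)] by (simp add: x(3) eigenvalue_map_eq[OF d] Rn_def)
  qed
  moreover have "permutation_invariant ?n Q"
    unfolding permutation_invariant_def
  proof (intro allI impI ballI)
    fix \<sigma> q assume \<sigma>: "\<sigma> permutes {..<?n}" and "q \<in> Q"
    then obtain x \<tau> where "x \<in> E" "\<tau> permutes {..<?n}" "q = eigenvalue_map V mul e x \<circ> \<tau>"
      by (auto simp: Q_def)
    then show "q \<circ> \<sigma> \<in> Q" using permutes_compose[OF \<sigma>] unfolding Q_def
      by (auto simp: comp_assoc)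
  qed
  moreover have "E = {x \<in> V. eigenvalue_map V mul e x \<in> Q}"
  proof (intro set_eqI iffI)
    fix x assume "x \<in> E"
    then have "eigenvalue_map V mul e x \<circ> id \<in> Q" using permutes_id unfolding Q_def by blast
    then show "x \<in> {x \<in> V. eigenvalue_map V mul e x \<in> Q}" using EV \<open>x \<in> E\<close> by auto
  next
    fix y assume "y \<in> {x \<in> V. eigenvalue_map V mul e x \<in> Q}"
    then obtain x \<sigma> where y: "y \<in> V" and x: "x \<in> E" and \<sigma>: "\<sigma> permutes {..<?n}"
      and xy: "eigenvalue_map V mul e y = eigenvalue_map V mul e x \<circ> \<sigma>"
      by (auto simp: Q_def)
    obtain l f where l: "ordered_decomposition x l f" using ordered_decomposition_exists x EV by blast
    obtain m g where m: "ordered_decomposition y m g" using ordered_decomposition_exists y by blast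
    have ml: "m = l \<circ> \<sigma>" using xy eigenvalue_map_eq[OF l] eigenvalue_map_eq[OF m] by simp
    have f: "frame_family {..<?n} f" and g: "frame_family {..<?n} g"
      and xl: "x = (\<Sum>i<?n. l i *\<^sub>R f i)" and ym: "y = (\<Sum>i<?n. m i *\<^sub>R g i)"
      using l m by (auto simp: ordered_decomposition_def)
    \<comment> \<open>Reordering the frame of \<open>x\<close> by \<sigma> lines its eigenvalues up
      with those of \<open>y\<close>.\<close>
    have "frame_family {..<?n} (f \<circ> \<sigma>)"
      using f permutes_inj_on[OF \<sigma>]
      unfolding frame_family_def image_comp[symmetric] permutes_image[OF \<sigma>]
      by (auto intro!: comp_inj_on simp: permutes_image[OF \<sigma>])
    then obtain A where A: "A \<in> jordan_Aut V mul" "\<forall>i<?n. A ((f \<circ> \<sigma>) i) = g i"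
      using frame_homogeneous_families[OF hom _ g] by blast
    have "A x = (\<Sum>i<?n. l i *\<^sub>R A (f i))"
      unfolding xl using frame_familyD(4)[OF f]
      by (subst jordan_Aut_sum[OF A(1)]) (auto simp: jordan_AutD(4)[OF A(1)] intro!: sum.cong)
    also have "\<dots> = (\<Sum>i<?n. l (\<sigma> i) *\<^sub>R A (f (\<sigma> i)))"
      using sum.permute[OF \<sigma>, of "\<lambda>i. l i *\<^sub>R A (f i)"] by (simp add: o_def)
    also have "\<dots> = y" using A(2) by (simp add: ym ml)
    finally show "y \<in> E" using EA[OF A(1) x] by simp
  qed
  ultimately show ?thesis unfolding spectral_set_def by blast
qed

text \<open>
  An automorphism that maps \<open>\<Sum>i. l i c i\<close> to \<open>\<Sum>i. l i \<sigma> (c i)\<close> for distinct \<open>l i\<close> has to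
  permute the frame by \<open>\<sigma>\<close>; the first orbit is a weakly spectral set, so it contains the second point.
\<close>

lemma spectral_imp_frame_homogeneous:
  assumes spec: "\<And>E. weakly_spectral_set V mul E \<Longrightarrow> spectral_set V mul e E"
  shows "frame_homogeneous"
  unfolding frame_homogeneous_def
proof (intro allI impI)
  fix F \<sigma> assume F: "jordan_frame V mul e F" and \<sigma>: "\<sigma> permutes F"
  define n where "n = card F"
  have rank: "jordan_rank V mul e = n" using jordan_rank_eq[OF F] by (simp add: n_def)
  obtain f where f: "bij_betw f {..<n} F"
    using ex_bij_betw_nat_finite[OF jordan_frameD(1)[OF F]] by (auto simp: n_def atLeast0LessThan)
  have ff: "frame_family {..<n} f" using f F by (simp add: frame_family_def bij_betw_def)
  have \<sigma>f: "frame_family {..<n} (\<sigma> \<circ> f)"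
    using ff permutes_inj_on[OF \<sigma>] f
    unfolding frame_family_def image_comp[symmetric] bij_betw_def
    by (auto intro!: comp_inj_on simp: permutes_image[OF \<sigma>])
  \<comment> \<open>These values are distinct and decreasing for i < n, and truncated subtraction
    makes them 0 from \<open>n\<close> on, as \<open>Rn\<close> requires.\<close>
  define l where "l i = real (n - i)" for i
  define x where "x = (\<Sum>i<n. l i *\<^sub>R f i)"
  define y where "y = (\<Sum>i<n. l i *\<^sub>R \<sigma> (f i))"
  have dx: "ordered_decomposition x l f" and dy: "ordered_decomposition y l (\<sigma> \<circ> f)"
    using ff \<sigma>f by (auto simp: ordered_decomposition_def rank x_def y_def l_def Rn_def)
  have xV: "x \<in> V" unfolding x_def using frame_familyD(4)[OF ff] by (auto intro!: subspace_sum[OF subspace])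
  have yV: "y \<in> V" unfolding y_def using frame_familyD(4)[OF \<sigma>f] by (auto intro!: subspace_sum[OF subspace])
  define E where "E = {A x | A. A \<in> jordan_Aut V mul}"
  have "weakly_spectral_set V mul E"
    unfolding weakly_spectral_set_def
  proof (intro conjI ballI subsetI)
    show "z \<in> V" if "z \<in> E" for z using that jordan_AutD(2) xV by (auto simp: E_def)
    show "z \<in> E" if B: "B \<in> jordan_Aut V mul" and z: "z \<in> B ` E" for B z
    proof -
      from z obtain A where "A \<in> jordan_Aut V mul" "z = (B \<circ> A) x" by (auto simp: E_def)
      then show ?thesis using jordan_Aut_comp[OF B] unfolding E_def by blast
    qed
  qed
  then obtain Q where Q: "E = {x \<in> V. eigenvalue_map V mul e x \<in> Q}"
    using spec unfolding spectral_set_def by blast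
  have "x \<in> E" unfolding E_def by (intro CollectI exI[of _ "\<lambda>x. x"] conjI refl jordan_Aut_id)
  then have "y \<in> E" using Q yV eigenvalue_map_eq[OF dx] eigenvalue_map_eq[OF dy] by auto
  then obtain A where A: "A \<in> jordan_Aut V mul" "y = A x" by (auto simp: E_def)
  have "A x = (\<Sum>i<n. l i *\<^sub>R (A \<circ> f) i)"
    unfolding x_def using frame_familyD(4)[OF ff]
    by (subst jordan_Aut_sum[OF A(1)]) (auto simp: jordan_AutD(4)[OF A(1)] intro!: sum.cong)
  then have eq: "(\<Sum>i<n. l i *\<^sub>R (A \<circ> f) i) = (\<Sum>i<n. l i *\<^sub>R (\<sigma> \<circ> f) i)"
    using A by (simp add: y_def)
  have "A (f i) = \<sigma> (f i)" if "i < n" for i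
  proof -
    \<comment> \<open>Each eigenvalue is simple, so its spectral idempotent is a single frame
      element on either side.\<close>
    have "{j. j \<in> {..<n} \<and> l j = l i} = {i}" using that by (auto simp: l_def)
    then show ?thesis
      using spectral_idempotents_eq[OF frame_family_Aut[OF ff A(1)] \<sigma>f eq, of "l i"] by simp
  qed
  then show "\<exists>A\<in>jordan_Aut V mul. \<forall>c\<in>F. A c = \<sigma> c"
    using A(1) f unfolding bij_betw_def by blast
qed

section \<open>Homogeneity of frames\<close>

lemma frame_family_inner:
  assumes f: "frame_family I f" and k: "k \<in> I"
  shows "(\<Sum>i\<in>I. a i *\<^sub>R f i) \<bullet> f k = a k * (f k \<bullet> f k)"
proof -
  note f = frame_familyD[OF f]
  have "(\<Sum>i\<in>I. a i *\<^sub>R f i) \<bullet> f k = (\<Sum>i\<in>I. a i * (f i \<bullet> f k))"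
    by (simp add: inner_sum_left)
  also have "\<dots> = (\<Sum>i\<in>I. if i = k then a k * (f k \<bullet> f k) else 0)"
    using idempotent_orthogonal_inner[OF f(4) f(4) f(5) f(6)] k by (intro sum.cong) auto
  finally show ?thesis using f(3) k by simp
qed

definition frame_coeff :: "('i \<Rightarrow> 'a) \<Rightarrow> 'a \<Rightarrow> 'i \<Rightarrow> real" where
  "frame_coeff f z i = (z \<bullet> f i) / (f i \<bullet> f i)"

lemma frame_coeff_sum:
  assumes "frame_family I f" "k \<in> I"
  shows "frame_coeff f (\<Sum>i\<in>I. a i *\<^sub>R f i) k = a k"
  using frame_family_inner[OF assms] frame_familyD(7)[OF assms] by (simp add: frame_coeff_def)

definition spanning_frame_family :: "'i set \<Rightarrow> ('i \<Rightarrow> 'a) \<Rightarrow> bool" where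
  "spanning_frame_family I f \<longleftrightarrow> frame_family I f \<and> (\<forall>z\<in>V. z = (\<Sum>i\<in>I. frame_coeff f z i *\<^sub>R f i))"

text \<open>By hypothesis no \<open>f i\<close> has a nonzero 1/2-space. So
  \<open>f i \<odot> z\<close> lies in the 1-space of \<open>f i\<close>, is a multiple of it by
  primitivity, and these products add up to \<open>e \<odot> z = z\<close>.\<close>

lemma spanning_frame_familyI:
  assumes f: "frame_family I f"
    and even: "\<And>i z. i \<in> I \<Longrightarrow> z \<in> V \<Longrightarrow> f i \<odot> (f i \<odot> z) = f i \<odot> z"
  shows "spanning_frame_family I f"
  unfolding spanning_frame_family_def
proof (intro conjI ballI)
  fix z assume z: "z \<in> V"
  note f' = frame_familyD[OF f]
  have "\<exists>r. f i \<odot> z = r *\<^sub>R f i" if i: "i \<in> I" for i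
  proof (rule primitive_peirce_1)
    show "primitive_idempotent V mul (f i)" using jordan_frameD(2)[OF f'(2)] i by blast
    show "f i \<odot> z \<in> peirce 1 (f i)" using even[OF i z] f'(4)[OF i] z by (simp add: peirce_def)
  qed
  then obtain a where a: "\<And>i. i \<in> I \<Longrightarrow> f i \<odot> z = a i *\<^sub>R f i" by metis
  have "z = (\<Sum>i\<in>I. f i) \<odot> z" using f'(8) z by (simp add: mul_linear)
  also have "\<dots> = (\<Sum>i\<in>I. f i \<odot> z)" using f'(4) z by (intro mul_sum_left) auto
  also have "\<dots> = (\<Sum>i\<in>I. a i *\<^sub>R f i)" using a by (intro sum.cong) auto
  finally have z': "z = (\<Sum>i\<in>I. a i *\<^sub>R f i)" .
  show "z = (\<Sum>i\<in>I. frame_coeff f z i *\<^sub>R f i)"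
    by (subst (1) z', rule sum.cong) (auto simp: z' frame_coeff_sum[OF f])
qed (rule f)

lemma frame_coeff_linear:
  "frame_coeff f (x + y) i = frame_coeff f x i + frame_coeff f y i"
  "frame_coeff f (a *\<^sub>R x) i = a * frame_coeff f x i"
  by (simp_all add: frame_coeff_def inner_simps add_divide_distrib)

lemma frame_coeff_mul:
  assumes f: "spanning_frame_family I f" and "x \<in> V" "y \<in> V" "k \<in> I"
  shows "frame_coeff f (x \<odot> y) k = frame_coeff f x k * frame_coeff f y k"
proof -
  have ff: "frame_family I f" using f by (simp add: spanning_frame_family_def)
  have "x \<odot> y = (\<Sum>i\<in>I. frame_coeff f x i *\<^sub>R f i) \<odot> (\<Sum>i\<in>I. frame_coeff f y i *\<^sub>R f i)"
    using assms by (simp add: spanning_frame_family_def)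
  also have "\<dots> = (\<Sum>i\<in>I. (frame_coeff f x i * frame_coeff f y i) *\<^sub>R f i)"
    by (rule frame_family_mul[OF ff])
  finally show ?thesis using frame_coeff_sum[OF ff \<open>k \<in> I\<close>] by simp
qed

lemma isomorphic_Rn_if_spanning:
  assumes f: "spanning_frame_family {..<n} f"
  shows "isomorphic_Rn V mul n"
proof -
  have ff: "frame_family {..<n} f" and span: "\<And>z. z \<in> V \<Longrightarrow> z = (\<Sum>i<n. frame_coeff f z i *\<^sub>R f i)"
    using f by (auto simp: spanning_frame_family_def)
  define \<phi> where "\<phi> z i = (if i < n then frame_coeff f z i else 0)" for z i
  have "bij_betw \<phi> V (Rn n)"
  proof (rule bij_betw_byWitness[where f' = "\<lambda>l. \<Sum>i<n. l i *\<^sub>R f i"])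
    show "\<forall>z\<in>V. (\<Sum>i<n. \<phi> z i *\<^sub>R f i) = z" using span by (simp add: \<phi>_def)
    show "\<forall>l\<in>Rn n. \<phi> (\<Sum>i<n. l i *\<^sub>R f i) = l"
      using frame_coeff_sum[OF ff] by (auto simp: \<phi>_def Rn_def)
    show "\<phi> ` V \<subseteq> Rn n" by (auto simp: \<phi>_def Rn_def)
    show "(\<lambda>l. \<Sum>i<n. l i *\<^sub>R f i) ` Rn n \<subseteq> V"
      using frame_familyD(4)[OF ff] by (auto intro!: subspace_sum[OF subspace])
  qed
  moreover have "\<phi> (x + y) = (\<lambda>i. \<phi> x i + \<phi> y i)" "\<phi> (a *\<^sub>R x) = (\<lambda>i. a * \<phi> x i)" for x y a
    by (auto simp: \<phi>_def frame_coeff_linear)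
  moreover have "\<phi> (x \<odot> y) = (\<lambda>i. \<phi> x i * \<phi> y i)" if "x \<in> V" "y \<in> V" for x y
    using frame_coeff_mul[OF f that] by (auto simp: \<phi>_def)
  ultimately show ?thesis unfolding isomorphic_Rn_def by blast
qed

lemma permutation_automorphism:
  assumes F: "spanning_frame_family F (\<lambda>c. c)" and \<sigma>: "\<sigma> permutes F"
  shows "\<exists>A\<in>jordan_Aut V mul. \<forall>c\<in>F. A c = \<sigma> c"
proof -
  let ?k = "frame_coeff (\<lambda>c. c)"
  have ff: "frame_family F (\<lambda>c. c)" and span: "\<And>z. z \<in> V \<Longrightarrow> z = (\<Sum>c\<in>F. ?k z c *\<^sub>R c)"
    using F by (auto simp: spanning_frame_family_def)
  note ff' = frame_familyD[OF ff]
  define A where "A \<tau> z = (\<Sum>c\<in>F. ?k z c *\<^sub>R \<tau> c)" for \<tau> :: "'a \<Rightarrow> 'a" and z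
  have AV: "A \<tau> z \<in> V" if "\<tau> permutes F" for \<tau> z
    unfolding A_def using ff'(4) permutes_in_image[OF that] by (auto intro!: subspace_sum[OF subspace])
  \<comment> \<open>Reindexed so that the coefficients of the image can be read off.\<close>
  have A': "A \<tau> z = (\<Sum>c\<in>F. ?k z (inv \<tau> c) *\<^sub>R c)" if "\<tau> permutes F" for \<tau> z
    unfolding A_def using sum.permute[OF permutes_inv[OF that], of "\<lambda>c. ?k z c *\<^sub>R \<tau> c"]
    by (simp add: o_def permutes_inverses[OF that])
  have coeff: "?k (A \<tau> z) c = ?k z (inv \<tau> c)" if "\<tau> permutes F" "c \<in> F" for \<tau> z c
    unfolding A'[OF that(1)] using frame_coeff_sum[OF ff that(2)] by simp
  have inverse: "A (inv \<tau>) (A \<tau> z) = z" if \<tau>: "\<tau> permutes F" and "z \<in> V" for \<tau> z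
  proof -
    have "A (inv \<tau>) (A \<tau> z) = (\<Sum>c\<in>F. ?k z (inv \<tau> c) *\<^sub>R inv \<tau> c)"
      using coeff[OF \<tau>] by (simp add: A_def[of "inv \<tau>"])
    also have "\<dots> = z"
      using sum.permute[OF permutes_inv[OF \<tau>], of "\<lambda>c. ?k z c *\<^sub>R c"] span[OF \<open>z \<in> V\<close>] by (simp add: o_def)
    finally show ?thesis .
  qed
  have "bij_betw (A \<sigma>) V V"
    using inverse[OF \<sigma>] inverse[OF permutes_inv[OF \<sigma>]] AV[OF \<sigma>] AV[OF permutes_inv[OF \<sigma>]]
    by (intro bij_betw_byWitness[where f' = "A (inv \<sigma>)"]) (auto simp: permutes_inv_inv[OF \<sigma>])
  moreover have "A \<sigma> (x + y) = A \<sigma> x + A \<sigma> y" "A \<sigma> (a *\<^sub>R x) = a *\<^sub>R A \<sigma> x" for x y a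
    by (simp_all add: A_def frame_coeff_linear scaleR_add_left sum.distrib scaleR_sum_right)
  moreover have "A \<sigma> (x \<odot> y) = A \<sigma> x \<odot> A \<sigma> y" if "x \<in> V" "y \<in> V" for x y
    unfolding A'[OF \<sigma>] frame_family_mul[OF ff]
    using frame_coeff_mul[OF F that] permutes_in_image[OF permutes_inv[OF \<sigma>]]
    by (intro sum.cong) auto
  ultimately have "A \<sigma> \<in> jordan_Aut V mul" by (simp add: jordan_Aut_def)
  moreover have "A \<sigma> c = \<sigma> c" if c: "c \<in> F" for c
  proof -
    have "A \<sigma> c = (\<Sum>d\<in>F. if d = c then \<sigma> c else 0)"
      unfolding A_def using idempotent_orthogonal_inner[OF ff'(4)[OF c] ff'(4) ff'(5)[OF c] ff'(6)[OF c]] ff'(7)[OF c]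
      by (intro sum.cong) (auto simp: frame_coeff_def)
    then show ?thesis using ff'(3) c by simp
  qed
  ultimately show ?thesis by blast
qed

text \<open>The componentwise product is associative, so
  \<open>c \<odot> (c \<odot> z) = c \<odot> z\<close> for every frame element. The frame therefore
  spans, and permuting its elements extends to an automorphism.\<close>

lemma isomorphic_Rn_imp_frame_homogeneous:
  assumes "isomorphic_Rn V mul n"
  shows "frame_homogeneous"
  unfolding frame_homogeneous_def
proof (intro allI impI)
  fix F \<sigma> assume F: "jordan_frame V mul e F" and \<sigma>: "\<sigma> permutes F"
  obtain \<phi> :: "'a \<Rightarrow> nat \<Rightarrow> real" where \<phi>: "inj_on \<phi> V" "\<And>x y. x \<in> V \<Longrightarrow> y \<in> V \<Longrightarrow> \<phi> (x \<odot> y) = (\<lambda>i. \<phi> x i * \<phi> y i)"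
    using assms unfolding isomorphic_Rn_def bij_betw_def by blast
  note F' = jordan_frameD[OF F]
  have "spanning_frame_family F (\<lambda>c. c)"
  proof (rule spanning_frame_familyI)
    show "frame_family F (\<lambda>c. c)" using F by (simp add: frame_family_def)
    fix c z assume c: "c \<in> F" and z: "z \<in> V"
    have "\<phi> (c \<odot> (c \<odot> z)) = \<phi> ((c \<odot> c) \<odot> z)"
      using F'(3)[OF c] z by (simp only: \<phi>(2) V_closed mult.assoc)
    then show "c \<odot> (c \<odot> z) = c \<odot> z"
      using inj_onD[OF \<phi>(1)] F'(3,4)[OF c] z by simp
  qed
  then show "\<exists>A\<in>jordan_Aut V mul. \<forall>c\<in>F. A c = \<sigma> c" using permutation_automorphism \<sigma> by blast
qed

section \<open>Simple algebras\<close>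

lemma frame_subset_sum:
  assumes F: "jordan_frame V mul e F" and "G \<subseteq> F"
  shows "\<Sum>G \<in> V" "\<And>c. c \<in> G \<Longrightarrow> \<Sum>G \<odot> c = c" "\<And>c. c \<in> F - G \<Longrightarrow> \<Sum>G \<odot> c = 0"
    "\<Sum>G \<odot> \<Sum>G = \<Sum>G" "e - \<Sum>G = \<Sum>(F - G)"
proof -
  note F' = jordan_frameD[OF F]
  have fin: "finite G" using F'(1) \<open>G \<subseteq> F\<close> finite_subset by blast
  have GV: "c \<in> V" if "c \<in> G" for c using F'(3) that \<open>G \<subseteq> F\<close> by blast
  show V: "\<Sum>G \<in> V" using GV by (auto intro!: subspace_sum[OF subspace])
  have expand: "\<Sum>G \<odot> c = (\<Sum>d\<in>G. d \<odot> c)" if "c \<in> V" for c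
    using mul_sum_left[of G "\<lambda>c. c" c] GV that by simp
  show in_G: "\<Sum>G \<odot> c = c" if "c \<in> G" for c
  proof -
    have "(\<Sum>d\<in>G. d \<odot> c) = (\<Sum>d\<in>G. if d = c then c else 0)"
      using F'(4,7) that \<open>G \<subseteq> F\<close> by (intro sum.cong) auto
    then show ?thesis using expand GV that fin by simp
  qed
  show "\<Sum>G \<odot> c = 0" if "c \<in> F - G" for c
    using expand[of c] F'(3,7) that \<open>G \<subseteq> F\<close> by (auto intro!: sum.neutral)
  have "\<Sum>G \<odot> \<Sum>G = (\<Sum>d\<in>G. \<Sum>G \<odot> d)"
    using mul_sum_right[of G "\<lambda>c. c" "\<Sum>G"] GV V by simp
  then show "\<Sum>G \<odot> \<Sum>G = \<Sum>G" using in_G by simp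
  show "e - \<Sum>G = \<Sum>(F - G)" using F'(1,8) \<open>G \<subseteq> F\<close> by (simp add: sum_diff)
qed

text \<open>
  If some two elements of the frame cannot be swapped, then the class of elements that can be swapped with
  the first one sums to an idempotent without Peirce 1/2-space, so the algebra splits.
\<close>

lemma simple_imp_swap:
  assumes simple: "jordan_simple V mul" and F: "jordan_frame V mul e F" and ab: "a \<in> F" "b \<in> F"
  shows "\<exists>A\<in>jordan_Aut V mul. \<forall>c\<in>F. A c = Transposition.transpose a b c"
proof (rule ccontr)
  define R where "R a b \<longleftrightarrow> (\<exists>A\<in>jordan_Aut V mul. \<forall>c\<in>F. A c = Transposition.transpose a b c)" for a b
  assume "\<not> ?thesis"
  then have "\<not> R a b" by (simp add: R_def)
  note F' = jordan_frameD[OF F]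
  have refl: "R x x" for x
    unfolding R_def using jordan_Aut_id by (intro bexI[of _ "\<lambda>x. x"]) auto
  \<comment> \<open>If \<open>z\<close> differs from both \<open>x\<close> and \<open>y\<close>,
    then (x y)(y z)(x y) = (x z) as transpositions; the remaining cases are immediate.\<close>
  have trans: "R x z" if xyz: "x \<in> F" "y \<in> F" "z \<in> F" and "R x y" "R y z" for x y z
  proof (cases "x = z \<or> y = z")
    case False
    obtain A B where A: "A \<in> jordan_Aut V mul" "\<forall>c\<in>F. A c = Transposition.transpose x y c"
      and B: "B \<in> jordan_Aut V mul" "\<forall>c\<in>F. B c = Transposition.transpose y z c"
      using \<open>R x y\<close> \<open>R y z\<close> by (auto simp: R_def)
    have inF: "Transposition.transpose x y c \<in> F" "Transposition.transpose y z c \<in> F" if "c \<in> F" for c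
      using that xyz by (auto simp: Transposition.transpose_def)
    have "(A \<circ> (B \<circ> A)) c = Transposition.transpose x z c" if "c \<in> F" for c
    proof -
      have "(A \<circ> (B \<circ> A)) c = Transposition.transpose x y (Transposition.transpose y z (Transposition.transpose x y c))"
        using A(2) B(2) inF that by simp
      then show ?thesis using False by (auto simp: Transposition.transpose_def split: if_splits)
    qed
    then show ?thesis unfolding R_def using jordan_Aut_comp A(1) B(1) by blast
  qed (use refl that in auto)
  define G where "G = {c \<in> F. R a c}"
  have G: "G \<subseteq> F" "a \<in> G" "b \<in> F - G" using ab refl \<open>\<not> R a b\<close> by (auto simp: G_def)
  \<comment> \<open>A nonzero product would let \<open>exchange_orthogonal\<close> swap
    \<open>c\<close> and \<open>d\<close>, putting \<open>d\<close> into the class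
    \<open>G\<close>.\<close>
  have zero: "c \<odot> (d \<odot> z) = 0" if c: "c \<in> G" and d: "d \<in> F - G" and z: "z \<in> V" for c d z
  proof (rule ccontr)
    assume nz: "c \<odot> (d \<odot> z) \<noteq> 0"
    have cd: "c \<in> F" "d \<in> F" "c \<noteq> d" using c d G by auto
    obtain p where p: "p \<in> V" "p \<odot> p = p" "peirce_reflection p c = d" "peirce_reflection p d = c"
      "\<And>h. \<lbrakk>h \<in> V; h \<odot> h = h; h \<odot> c = 0; h \<odot> d = 0\<rbrakk> \<Longrightarrow> h \<odot> p = 0"
      using exchange_orthogonal[OF F'(2)[OF cd(1)] F'(2)[OF cd(2)] F'(7)[OF cd] z nz] by metis
    have "peirce_reflection p h = Transposition.transpose c d h" if h: "h \<in> F" for h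
    proof (cases "h = c \<or> h = d")
      case False
      then have "h \<odot> p = 0" using F'(3,4,7) h cd by (intro p(5)) auto
      then have "peirce_reflection p h = h" using peirce_reflection_fixes p(1) F'(3)[OF h] by blast
      then show ?thesis using False by simp
    qed (use p in auto)
    then have "R c d" unfolding R_def using peirce_reflection_Aut[OF p(1,2)] by blast
    then have "R a d" using trans[of a c d] ab cd c by (simp add: G_def)
    then show False using d by (simp add: G_def)
  qed
  define u where "u = \<Sum>G"
  note u = frame_subset_sum[OF F G(1), folded u_def]
  \<comment> \<open>Expanding \<open>u\<close> and \<open>e - u\<close> over the frame writes
    \<open>u \<odot> ((e - u) \<odot> z)\<close> as a sum of the products just shown to
    vanish.\<close>
  have even: "u \<odot> (u \<odot> z) = u \<odot> z" if z: "z \<in> V" for z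
  proof -
    have "u \<odot> (\<Sum>(F - G) \<odot> z) = u \<odot> (\<Sum>d\<in>F - G. d \<odot> z)"
      using mul_sum_left[of "F - G" "\<lambda>c. c" z] F'(3) z by simp
    also have "\<dots> = (\<Sum>d\<in>F - G. u \<odot> (d \<odot> z))"
      using F'(3) z u by (intro mul_sum_right) auto
    also have "\<dots> = 0"
    proof (rule sum.neutral, rule ballI)
      fix d assume d: "d \<in> F - G"
      then have "u \<odot> (d \<odot> z) = (\<Sum>c\<in>G. c \<odot> (d \<odot> z))"
        unfolding u_def using F'(3) G z by (intro mul_sum_left[of G "\<lambda>c. c"]) auto
      then show "u \<odot> (d \<odot> z) = 0" using zero[OF _ d z] by simp
    qed
    finally have "u \<odot> ((e - u) \<odot> z) = 0" using u(5) by simp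
    then show ?thesis using u(1) z by (simp add: mul_linear)
  qed
  have "jordan_direct_sum V mul (peirce 1 u) (peirce 0 u)"
    unfolding jordan_direct_sum_def
  proof (intro conjI exI ballI)
    show "euclidean_jordan_algebra (peirce 1 u) mul u"
      using euclidean_jordan_algebra_peirce_1 u by blast
    show "euclidean_jordan_algebra (peirce 0 u) mul (e - u)"
      using euclidean_jordan_algebra_peirce_1[of "e - u"] idempotent_complement[of u] u(1,4) by simp
    show "V = {x + y |x y. x \<in> peirce 1 u \<and> y \<in> peirce 0 u}"
    proof (intro equalityI subsetI)
      fix z assume "z \<in> V"
      then show "z \<in> {x + y |x y. x \<in> peirce 1 u \<and> y \<in> peirce 0 u}"
        using even_part_decomposition[OF u(1,4), of z] even by (auto simp: even_part_def)
    qed (auto simp: peirce_def)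
    show "peirce 1 u \<inter> peirce 0 u = {0}"
      using peirce_Int[of _ 1 u 0] subspace_0[OF subspace_peirce[OF u(1)]] by auto
    show "x \<odot> y = 0" if "x \<in> peirce 1 u" "y \<in> peirce 0 u" for x y
      using peirce_10[OF u(1,4)] that by blast
  qed
  moreover have "a \<in> peirce 1 u" "b \<in> peirce 0 u" using u(2,3) G F'(3) by (auto simp: peirce_def)
  then have "peirce 1 u \<noteq> {0}" "peirce 0 u \<noteq> {0}" using F'(5) ab by auto
  ultimately show False using simple unfolding jordan_simple_def by blast
qed

lemma simple_imp_frame_homogeneous:
  assumes simple: "jordan_simple V mul"
  shows "frame_homogeneous"
  unfolding frame_homogeneous_def
proof (intro allI impI)
  fix F \<sigma> assume F: "jordan_frame V mul e F" and \<sigma>: "\<sigma> permutes F"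
  from \<sigma> jordan_frameD(1)[OF F] show "\<exists>A\<in>jordan_Aut V mul. \<forall>c\<in>F. A c = \<sigma> c"
  proof (induction rule: permutes_induct)
    case id
    then show ?case using jordan_Aut_id by (intro bexI[of _ "\<lambda>x. x"]) auto
  next
    case (swap a b p)
    then obtain A where A: "A \<in> jordan_Aut V mul" "\<forall>c\<in>F. A c = p c" by blast
    obtain B where B: "B \<in> jordan_Aut V mul" "\<forall>c\<in>F. B c = Transposition.transpose a b c"
      using simple_imp_swap[OF simple F swap(1,2)] by blast
    have "\<forall>c\<in>F. (B \<circ> A) c = (Transposition.transpose a b \<circ> p) c"
      using A B permutes_in_image[OF \<open>p permutes F\<close>] by simp
    then show ?case using jordan_Aut_comp[OF B(1) A(1)] by blast
  qed
qed

section \<open>Decomposable algebras\<close>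

text \<open>Otherwise the unit, as the sum of the frame, would lie in \<open>V2\<close> and
  annihilate \<open>V1\<close>.\<close>

lemma frame_meets_summand:
  assumes V: "jordan_direct_sum V mul V1 V2" "V1 \<noteq> {0}" and F: "jordan_frame V mul e F"
    and split: "\<And>c. c \<in> F \<Longrightarrow> c \<in> V1 \<or> c \<in> V2"
  shows "\<exists>c\<in>F. c \<in> V1"
proof (rule ccontr)
  assume "\<not> (\<exists>c\<in>F. c \<in> V1)"
  then have F2: "\<And>c. c \<in> F \<Longrightarrow> c \<in> V2" using split by blast
  obtain e2 where "euclidean_jordan_algebra V2 mul e2" using V(1) by (auto simp: jordan_direct_sum_def)
  then have sub2: "subspace V2" by (rule euclidean_jordan_algebra.subspace)
  obtain e1 where "euclidean_jordan_algebra V1 mul e1" using V(1) by (auto simp: jordan_direct_sum_def)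
  then have sub1: "subspace V1" by (rule euclidean_jordan_algebra.subspace)
  have "e \<in> V2"
    unfolding jordan_frameD(8)[OF F, symmetric] using F2 by (intro subspace_sum[OF sub2])
  have "x = 0" if x: "x \<in> V1" for x
  proof -
    have "x + 0 \<in> V" using V(1) x subspace_0[OF sub2] unfolding jordan_direct_sum_def by blast
    then have "x = x \<odot> e" by (simp add: mul_linear)
    also have "\<dots> = 0" using V(1) x \<open>e \<in> V2\<close> unfolding jordan_direct_sum_def by blast
    finally show ?thesis .
  qed
  then show False using V(2) subspace_0[OF sub1] by blast
qed

lemma frame_homogeneous_imp_essentially_simple:
  assumes hom: "frame_homogeneous"
  shows "essentially_simple V mul"
proof (cases "jordan_simple V mul")
  case False
  then obtain V1 V2 where nz: "V1 \<noteq> {0}" "V2 \<noteq> {0}" and sum: "jordan_direct_sum V mul V1 V2"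
    by (auto simp: jordan_simple_def)
  obtain e1 where "euclidean_jordan_algebra V1 mul e1" using sum by (auto simp: jordan_direct_sum_def)
  then interpret V1: euclidean_jordan_algebra V1 mul e1 .
  obtain e2 where "euclidean_jordan_algebra V2 mul e2" using sum by (auto simp: jordan_direct_sum_def)
  then interpret V2: euclidean_jordan_algebra V2 mul e2 .
  have V: "V = {x + y | x y. x \<in> V1 \<and> y \<in> V2}" and Int: "V1 \<inter> V2 = {0}"
    and orth: "\<And>x y. x \<in> V1 \<Longrightarrow> y \<in> V2 \<Longrightarrow> x \<odot> y = 0"
    using sum by (auto simp: jordan_direct_sum_def)
  have sub1: "x \<in> V" if "x \<in> V1" for x unfolding V using that V2.V_closed(6) by force
  have sub2: "y \<in> V" if "y \<in> V2" for y unfolding V using that V1.V_closed(6) by force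
  have orth': "y \<odot> x = 0" if "x \<in> V1" "y \<in> V2" for x y
    using orth[OF that] mul_commute[OF sub2[OF that(2)] sub1[OF that(1)]] by simp
  have "jordan_direct_sum V mul V2 V1"
    unfolding jordan_direct_sum_def
  proof (intro conjI)
    have "{x + y |x y. x \<in> A \<and> y \<in> B} \<subseteq> {x + y |x y. x \<in> B \<and> y \<in> A}" for A B :: "'a set"
      by clarify (metis add.commute)
    then show "V = {x + y |x y. x \<in> V2 \<and> y \<in> V1}" unfolding V by (intro equalityI)
    show "V2 \<inter> V1 = {0}" using Int by blast
  qed (use orth' V1.euclidean_jordan_algebra_axioms V2.euclidean_jordan_algebra_axioms in blast)+
  obtain F where F: "jordan_frame V mul e F" using jordan_frame_exists by blast
  note F' = jordan_frameD[OF F]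
  \<comment> \<open>The components of \<open>c\<close> in the two summands are idempotent, so
    primitivity makes one of them 0.\<close>
  have split: "c \<in> V1 \<or> c \<in> V2" if c: "c \<in> F" for c
  proof -
    obtain x y where xy: "x \<in> V1" "y \<in> V2" "c = x + y" using F'(3)[OF c] by (auto simp: V)
    have "x \<odot> x + y \<odot> y = x + y"
      using F'(4)[OF c] xy orth orth' sub1 sub2 by (simp add: mul_linear)
    then have eq: "x \<odot> x - x = y - y \<odot> y" by (simp add: algebra_simps)
    have "x \<odot> x - x \<in> V1" "y - y \<odot> y \<in> V2" using xy by auto
    then have "x \<odot> x - x \<in> V1 \<inter> V2" unfolding eq[symmetric] by (rule IntI)
    then have "x \<odot> x - x = 0" using Int by blast
    then have "x \<odot> x = x" "y \<odot> y = y" using eq by simp_all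
    then have "x = 0 \<or> y = 0"
      using F'(2)[OF c] xy sub1 sub2 unfolding primitive_idempotent_def jordan_idempotent_def by blast
    then show ?thesis using xy by auto
  qed
  obtain c where c: "c \<in> F" "c \<in> V1" using frame_meets_summand[OF sum nz(1) F split] by blast
  obtain d where d: "d \<in> F" "d \<in> V2"
    using frame_meets_summand[OF \<open>jordan_direct_sum V mul V2 V1\<close> nz(2) F] split by blast
  have "c \<noteq> d" using c d Int F'(5) by blast
  have zero: "c \<odot> (d \<odot> z) = 0" if "z \<in> V" for z
  proof -
    obtain x y where xy: "x \<in> V1" "y \<in> V2" "z = x + y" using \<open>z \<in> V\<close> by (auto simp: V)
    have "d \<odot> z = d \<odot> y" using xy d orth' sub1 sub2 by (simp add: mul_linear)
    then show ?thesis using orth c(2) d(2) xy(2) V2.mul_closed by simp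
  qed
  have zero': "c' \<odot> (d' \<odot> z) = 0" if c': "c' \<in> F" and d': "d' \<in> F" and "c' \<noteq> d'" and z: "z \<in> V" for c' d' z
  proof -
    \<comment> \<open>The place to which \<open>d\<close> moves when \<open>c\<close> and
      \<open>c'\<close> are transposed; a second transposition takes it to \<open>d'\<close> without
      touching \<open>c'\<close>.\<close>
    define d'' where "d'' = Transposition.transpose c c' d"
    have d'': "d'' \<in> F" "d'' \<noteq> c'" using \<open>c \<noteq> d\<close> d(1) c(1) c' by (auto simp: d''_def Transposition.transpose_def)
    define \<sigma> where "\<sigma> = Transposition.transpose d'' d' \<circ> Transposition.transpose c c'"
    have "\<sigma> permutes F"
      unfolding \<sigma>_def by (intro permutes_compose permutes_swap_id c d c' d' d'')
    moreover have \<sigma>: "\<sigma> c = c'" "\<sigma> d = d'"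
      using d''(2) \<open>c' \<noteq> d'\<close> by (simp_all add: \<sigma>_def flip: d''_def)
    ultimately obtain A where A: "A \<in> jordan_Aut V mul" "A c = c'" "A d = d'"
      using hom F c(1) d(1) unfolding frame_homogeneous_def by metis
    obtain w where w: "w \<in> V" "A w = z" using jordan_AutD(7)[OF A(1) z] by blast
    have "c' \<odot> (d' \<odot> z) = A (c \<odot> (d \<odot> w))"
      using jordan_AutD(5)[OF A(1)] A w F'(3) c(1) d(1) by simp
    then show ?thesis using zero[OF w(1)] jordan_Aut_zero[OF A(1)] by simp
  qed
  obtain f where f: "bij_betw f {..<card F} F"
    using ex_bij_betw_nat_finite[OF F'(1)] by (auto simp: atLeast0LessThan)
  have "spanning_frame_family {..<card F} f"
  proof (rule spanning_frame_familyI)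
    show "frame_family {..<card F} f" using f F by (simp add: frame_family_def bij_betw_def)
    fix i z assume "i \<in> {..<card F}" and z: "z \<in> V"
    then have fi: "f i \<in> F" using f by (auto simp: bij_betw_def)
    \<comment> \<open>Inserting the unit as the sum of the frame, every term but the one for
      \<open>f i\<close> itself vanishes by \<open>zero'\<close>.\<close>
    have "f i \<odot> z = f i \<odot> (\<Sum>F \<odot> z)" using z F'(8) by (simp add: mul_linear)
    also have "\<dots> = f i \<odot> (\<Sum>d\<in>F. d \<odot> z)"
      using mul_sum_left[of F "\<lambda>c. c" z] F'(3) z by simp
    also have "\<dots> = (\<Sum>d\<in>F. f i \<odot> (d \<odot> z))" using F'(3) fi z by (intro mul_sum_right) auto
    also have "\<dots> = (\<Sum>d\<in>F. if d = f i then f i \<odot> (f i \<odot> z) else 0)"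
      using zero'[OF fi _ _ z] by (intro sum.cong) auto
    finally show "f i \<odot> (f i \<odot> z) = f i \<odot> z" using F'(1) fi by simp
  qed
  then show ?thesis using isomorphic_Rn_if_spanning unfolding essentially_simple_def by blast
qed (simp add: essentially_simple_def)

end

theorem theorem7:
  fixes V :: "'a::euclidean_space set"
    and mul :: "'a \<Rightarrow> 'a \<Rightarrow> 'a"
    and e :: 'a
  assumes "euclidean_jordan_algebra V mul e"
    and "V \<noteq> {0}"
  shows "essentially_simple V mul \<longleftrightarrow>
    (\<forall>E. weakly_spectral_set V mul E \<longrightarrow> spectral_set V mul e E)"
proof -
  interpret euclidean_jordan_algebra V mul e by fact
  have "essentially_simple V mul \<longleftrightarrow> frame_homogeneous"
    using isomorphic_Rn_imp_frame_homogeneous simple_imp_frame_homogeneous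
      frame_homogeneous_imp_essentially_simple
    unfolding essentially_simple_def by blast
  also have "\<dots> \<longleftrightarrow> (\<forall>E. weakly_spectral_set V mul E \<longrightarrow> spectral_set V mul e E)"
    using frame_homogeneous_imp_spectral spectral_imp_frame_homogeneous by blast
  finally show ?thesis .
qed

end
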